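(* Let $n$ be an even square-free positive integer, let $S\subseteq\mathbb{Z}_n$ with $S=-S$, $0\notin S$, and suppose $\Gamma=\mathrm{Cay}(\mathbb{Z}_n,S)$ is connected and non-bipartite. Then $\Gamma$ is unstable if and only if (i) there exists a nonzero $h\in2\mathbb{Z}_n$ such that $(S\cap2\mathbb{Z}_n)+h=S\cap2\mathbb{Z}_n$, or (ii) there exists a positive integer $l$ coprime to $n$ such that $lS=S+\frac n2$.
   Context: $\mathrm{Cay}(\mathbb{Z}_n,S)$ has vertex set $\mathbb{Z}_n$ with $x,y$ adjacent iff $y-x\in S$; $lS=\{ls\mid s\in S\}$, $2\mathbb{Z}_n=\{2x\mid x\in\mathbb{Z}_n\}$. For a graph $\Gamma=(V,E)$, $K_2$ is the graph on $\{0,1\}$ with one edge, and $\Gamma\times K_2$ is the tensor product: vertex set $V\times\{0,1\}$, with $(v,i)$ adjacent to $(w,j)$ iff $(v,w)\in E$ and $i\neq j$. $\Gamma$ is stable if $\mathrm{Aut}(\Gamma\times K_2)=\mathrm{Aut}(\Gamma)\times\mathrm{Aut}(K_2)$ (i.e. every automorphism has the form $(v,i)\mapsto(\varphi(v),\psi(i))$ with $\varphi\in\mathrm{Aut}(\Gamma)$, $\psi\in\mathrm{Sym}\{0,1\}$), and unstable otherwise. *)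

theory Defs
  imports
    "Graph_Theory.Digraph_Component"
    "HOL-Algebra.Bij"
    "HOL-Computational_Algebra.Squarefree"
begin

text \<open>
  The ring of integers modulo \<open>n\<close> is represented by the residues \<open>0, \<dots>, n - 1\<close>, with all
  arithmetic followed by reduction modulo \<open>n\<close>.
\<close>

definition Zn :: "nat \<Rightarrow> int set" where
  "Zn n = {0..<int n}"

definition even_Zn :: "nat \<Rightarrow> int set" where
  "even_Zn n = (\<lambda>x. (2 * x) mod int n) ` Zn n"

definition translate :: "nat \<Rightarrow> int set \<Rightarrow> int \<Rightarrow> int set" where
  "translate n A h = (\<lambda>s. (s + h) mod int n) ` A"

definition dilate :: "nat \<Rightarrow> int \<Rightarrow> int set \<Rightarrow> int set" where
  "dilate n l A = (\<lambda>s. (l * s) mod int n) ` A"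

text \<open>
  A graph is a \<^typ>\<open>'a pair_pre_digraph\<close> with a symmetric arc set: the edge between \<open>x\<close> and
  \<open>y\<close> is the pair of arcs \<open>(x, y)\<close> and \<open>(y, x)\<close>. The arcs of \<open>Cay n S\<close> are symmetric and
  loop-free exactly when \<open>S = -S\<close> and \<open>0 \<notin> S\<close> (for \<open>S\<close> contained in \<open>Zn n\<close> and \<open>n > 0\<close>).
\<close>

definition Cay :: "nat \<Rightarrow> int set \<Rightarrow> int pair_pre_digraph" where
  "Cay n S = \<lparr> pverts = Zn n,
     parcs = {(x, y). x \<in> Zn n \<and> y \<in> Zn n \<and> (y - x) mod int n \<in> S} \<rparr>"

definition K2 :: "nat pair_pre_digraph" where
  "K2 = \<lparr> pverts = {0, 1}, parcs = {(0, 1), (1, 0)} \<rparr>"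

definition tensor_product ::
  "'a pair_pre_digraph \<Rightarrow> 'b pair_pre_digraph \<Rightarrow> ('a \<times> 'b) pair_pre_digraph" where
  "tensor_product G H = \<lparr> pverts = pverts G \<times> pverts H,
     parcs = {((v, i), (w, j)). (v, w) \<in> parcs G \<and> (i, j) \<in> parcs H} \<rparr>"

definition bipartite :: "'a pair_pre_digraph \<Rightarrow> bool" where
  "bipartite G \<longleftrightarrow> (\<exists>A B. A \<union> B = pverts G \<and> A \<inter> B = {} \<and>
     (\<forall>(x, y) \<in> parcs G. (x \<in> A \<and> y \<in> B) \<or> (x \<in> B \<and> y \<in> A)))"

text \<open>
  \<^const>\<open>Bij\<close> consists of extensional functions (equal to \<^const>\<open>undefined\<close> off the vertex set),
  so an automorphism is determined by its values on the vertices, and products of automorphisms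
  have to be restricted to the product vertex set.
\<close>

definition Aut :: "'a pair_pre_digraph \<Rightarrow> ('a \<Rightarrow> 'a) set" where
  "Aut G = {f \<in> Bij (pverts G). \<forall>x \<in> pverts G. \<forall>y \<in> pverts G.
     (f x, f y) \<in> parcs G \<longleftrightarrow> (x, y) \<in> parcs G}"

definition stable :: "'a pair_pre_digraph \<Rightarrow> bool" where
  "stable G \<longleftrightarrow> Aut (tensor_product G K2) =
     (\<lambda>(\<phi>, \<psi>). restrict (map_prod \<phi> \<psi>) (pverts G \<times> pverts K2)) ` (Aut G \<times> Aut K2)"

abbreviation unstable :: "'a pair_pre_digraph \<Rightarrow> bool" where
  "unstable G \<equiv> \<not> stable G"

end

(*
An automorphism of Cay(Z_n, S) x K_2 that preserves the two layers is a pair of permutations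
alpha, beta of Z_n with: y - x in S iff beta(y) - alpha(x) in S. Functions F on Z_n satisfying the
analogous invariance are closed under convolution, so Schur's two arguments apply: the p-th
convolution power of F, taken mod p, is the push-forward of F along multiplication by p. For p prime
to n this shows that all dilates of S are invariant. For p dividing n it yields an invariant set,
contained in p Z_n, that contains p x whenever S is not constant on x + (n/p) Z_n.

Let m = n/2. If (i) fails, then for every odd p that set contains an even element, and its m-fold
sumset is an invariant subset of p Z_n containing 0. Intersecting over p leaves only {0} or {0, m},
so beta = alpha or beta - alpha takes values in {0, m}; in the unstable case we normalise to
alpha(0) = 0, beta(0) = m.

For each prime p dividing n, the invariant set above generates a subgroup d_p Z_n with p | d_p whose
cosets are respected by alpha and beta, and membership in S of x is independent of x mod p as soon
as x is nonzero modulo some prime q dividing d_p, q distinct from p. Choose l with l = beta(e_p) mod p wherever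
this is nonzero, e_p being the CRT idempotent of p. For the sum e_J of the e_p, p in J, the elements
beta(e_J) and l e_J + m agree up to coordinates on which S does not depend, so e_J in S iff
l e_J + m in S. Every x is a unit multiple of some e_J, and all dilates of S are invariant, so
l S = S + m.
*)

theory Submission
  imports
    Defs
    "HOL-Number_Theory.Cong"
    "HOL-Computational_Algebra.Polynomial"
begin

section \<open>Congruences and the group ring modulo a prime\<close>

text \<open>All multiplicities in \<open>d\<close> are at most 1, so one factor of each prime
  suffices. Moduli dividing a square-free number can therefore be handled one prime at a
  time.\<close>

lemma squarefree_dvd_iff:
  fixes d x :: int
  assumes "squarefree d"
  shows "d dvd x \<longleftrightarrow> (\<forall>p. prime p \<longrightarrow> p dvd d \<longrightarrow> p dvd x)"
proof
  assume *: "\<forall>p. prime p \<longrightarrow> p dvd d \<longrightarrow> p dvd x"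
  have "d \<noteq> 0" using assms by auto
  show "d dvd x"
  proof (cases "x = 0")
    case False
    have "multiplicity p d \<le> multiplicity p x" if "prime p" for p
    proof (cases "p dvd d")
      case True
      have "multiplicity p d \<le> 1"
        using assms that \<open>d \<noteq> 0\<close> by (auto simp: squarefree_factorial_semiring'')
      moreover have "p ^ 1 dvd x" using * that True by simp
      then have "multiplicity p x \<ge> 1"
        using False that by (intro multiplicity_geI) auto
      ultimately show ?thesis by linarith
    qed (simp add: not_dvd_imp_multiplicity_0)
    then show ?thesis
      using \<open>d \<noteq> 0\<close> False by (intro multiplicity_le_imp_dvd) auto
  qed simp
qed (auto intro: dvd_trans)

text \<open>Induction on the primes, since a new prime is coprime to the product of the earlier
  ones. Elements with prescribed coordinates are assembled in this way throughout.\<close>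

lemma crt_primes:
  fixes n :: int and u :: "int \<Rightarrow> int"
  assumes "n \<noteq> 0"
  shows "\<exists>x. \<forall>p. prime p \<longrightarrow> p dvd n \<longrightarrow> [x = u p] (mod p)"
proof -
  have "\<exists>x. \<forall>p\<in>A. [x = u p] (mod p)" if "finite A" "\<forall>p\<in>A. prime p" for A
    using that
  proof (induction A)
    case (insert q A)
    then obtain x where x: "\<forall>p\<in>A. [x = u p] (mod p)" by auto
    have "coprime q (\<Prod>A)"
      using insert by (intro prod_coprime_right) (auto intro: primes_coprime)
    then obtain y where y: "[y = u q] (mod q)" "[y = x] (mod \<Prod>A)"
      using binary_chinese_remainder_int by blast
    have "[y = u p] (mod p)" if "p \<in> A" for p
    proof -
      have "p dvd \<Prod>A" using dvd_prodI[OF insert(1) that, of "\<lambda>x. x"] by simp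
      then show ?thesis using cong_dvd_modulus[OF y(2)] x that cong_trans by blast
    qed
    then show ?case using y(1) by auto
  qed simp
  then obtain x where "\<forall>p\<in>prime_factors n. [x = u p] (mod p)"
    using in_prime_factors_imp_prime by (metis finite_set_mset)
  then show ?thesis using assms by (meson in_prime_factors_iff)
qed

text \<open>The set is a subgroup of the integers, generated by its least positive element;
  \<open>n\<close> shows that one exists.\<close>

lemma additive_set_eq_multiples:
  fixes H :: "int set" and n :: int
  assumes "n > 0" "n \<in> H" "\<And>x y. x \<in> H \<Longrightarrow> y \<in> H \<Longrightarrow> x - y \<in> H"
  obtains d where "d > 0" "\<And>x. x \<in> H \<longleftrightarrow> d dvd x"
proof -
  define k where "k = (LEAST k. k > 0 \<and> int k \<in> H)"
  have k: "k > 0 \<and> int k \<in> H"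
    unfolding k_def by (rule LeastI[of _ "nat n"]) (use assms in auto)
  have z: "0 \<in> H" using assms(3)[OF assms(2) assms(2)] by simp
  have neg: "- x \<in> H" if "x \<in> H" for x using assms(3)[OF z that] by simp
  have add: "x + y \<in> H" if "x \<in> H" "y \<in> H" for x y
    using assms(3)[OF that(1) neg[OF that(2)]] by simp
  have mulnat: "int i * x \<in> H" if "x \<in> H" for i x
    by (induction i) (auto simp: z add that algebra_simps)
  have mul: "i * x \<in> H" if "x \<in> H" for i x
    by (cases i rule: int_cases2) (use mulnat[OF that] neg in auto)
  have "x \<in> H \<longleftrightarrow> int k dvd x" for x
  proof
    assume "x \<in> H"
    then have "x - (x div int k) * int k \<in> H" using assms(3) mul k by blast
    then have m: "x mod int k \<in> H" by (simp add: minus_div_mult_eq_mod)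
    show "int k dvd x"
    proof (rule ccontr)
      assume "\<not> int k dvd x"
      then have "x mod int k > 0" using k
        by (metis dvd_eq_mod_eq_0 of_nat_0_less_iff order_le_less pos_mod_sign)
      then have "k \<le> nat (x mod int k)"
        using Least_le[of "\<lambda>k. k > 0 \<and> int k \<in> H" "nat (x mod int k)"] m k_def by simp
      then show False using k pos_mod_bound[of "int k" x] by linarith
    qed
  next
    assume "int k dvd x"
    then show "x \<in> H" using mul k by (metis dvd_def mult.commute)
  qed
  then show ?thesis using that[of "int k"] k by auto
qed

text \<open>The inner binomial coefficients are divisible by \<open>p\<close>. Divisibility by
  \<open>of_nat p\<close> in any commutative ring avoids a quotient and covers integer
  polynomials.\<close>

lemma freshmans_dream_cong:
  fixes a b :: "'a :: comm_ring_1"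
  assumes "prime p"
  shows "of_nat p dvd (a + b) ^ p - (a ^ p + b ^ p)"
proof -
  have p: "p > 0" using assms prime_gt_0_nat by blast
  have "(a + b) ^ p = (\<Sum>k\<le>p. of_nat (p choose k) * a ^ k * b ^ (p - k))"
    by (rule binomial_ring)
  also have "\<dots> = (\<Sum>k\<in>{0,p}. of_nat (p choose k) * a ^ k * b ^ (p - k))
      + (\<Sum>k\<in>{..p} - {0,p}. of_nat (p choose k) * a ^ k * b ^ (p - k))"
    by (subst sum.subset_diff[of "{0,p}"]) (auto simp: add.commute)
  finally have "(a + b) ^ p - (a ^ p + b ^ p) =
      (\<Sum>k\<in>{..p} - {0,p}. of_nat (p choose k) * a ^ k * b ^ (p - k))"
    using p by simp
  moreover have "of_nat p dvd (of_nat (p choose k) * a ^ k * b ^ (p - k))"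
    if "k \<in> {..p} - {0,p}" for k
  proof -
    have "p dvd (p choose k)"
      using that assms by (intro dvd_choose_prime) auto
    then show ?thesis by (auto intro: dvd_mult2)
  qed
  ultimately show ?thesis by (metis (no_types, lifting) dvd_sum)
qed

lemma freshmans_dream_sum_cong:
  fixes f :: "'b \<Rightarrow> 'a :: comm_ring_1"
  assumes "prime p" "finite A"
  shows "of_nat p dvd (\<Sum>x\<in>A. f x) ^ p - (\<Sum>x\<in>A. f x ^ p)"
  using assms(2)
proof (induction A)
  case empty
  then show ?case using assms(1) prime_gt_0_nat by (simp add: power_0_left)
next
  case (insert x A)
  have "of_nat p dvd ((f x + sum f A) ^ p - (f x ^ p + sum f A ^ p))
      + (sum f A ^ p - (\<Sum>x\<in>A. f x ^ p))"
    by (intro dvd_add freshmans_dream_cong insert assms)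
  then show ?case using insert by (simp add: algebra_simps)
qed

text \<open>
  Integer polynomials modulo \<open>X\<^sup>n - 1\<close> model the group ring of \<open>\<int>/n\<close>; working with
  polynomials makes its ring structure and powers available.
\<close>

definition wrap_coeff :: "int \<Rightarrow> int poly \<Rightarrow> int \<Rightarrow> int" where
  "wrap_coeff n Q t = (\<Sum>i\<le>degree Q. if [int i = t] (mod n) then coeff Q i else 0)"

lemma wrap_coeff_bound:
  assumes "degree Q \<le> N"
  shows "wrap_coeff n Q t = (\<Sum>i\<le>N. if [int i = t] (mod n) then coeff Q i else 0)"
  unfolding wrap_coeff_def
  by (rule sum.mono_neutral_left) (use assms in \<open>auto simp: coeff_eq_0\<close>)

lemma wrap_coeff_0 [simp]: "wrap_coeff n 0 t = 0"
  unfolding wrap_coeff_def by (rule sum.neutral) simp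

lemma wrap_coeff_add: "wrap_coeff n (P + Q) t = wrap_coeff n P t + wrap_coeff n Q t"
proof -
  let ?N = "max (degree P) (degree Q)"
  let ?c = "\<lambda>Q i. if [int i = t] (mod n) then coeff Q i else 0"
  have "wrap_coeff n (P + Q) t = (\<Sum>i\<le>?N. ?c (P + Q) i)"
    by (rule wrap_coeff_bound) (rule degree_add_le_max)
  also have "\<dots> = (\<Sum>i\<le>?N. ?c P i + ?c Q i)" by (rule sum.cong) auto
  also have "\<dots> = (\<Sum>i\<le>?N. ?c P i) + (\<Sum>i\<le>?N. ?c Q i)" by (rule sum.distrib)
  also have "\<dots> = wrap_coeff n P t + wrap_coeff n Q t"
    by (simp only: wrap_coeff_bound[of P ?N] wrap_coeff_bound[of Q ?N] max.cobounded1 max.cobounded2)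
  finally show ?thesis .
qed

lemma wrap_coeff_smult: "wrap_coeff n (smult c Q) t = c * wrap_coeff n Q t"
proof -
  have "wrap_coeff n (smult c Q) t =
      (\<Sum>i\<le>degree Q. if [int i = t] (mod n) then coeff (smult c Q) i else 0)"
    by (rule wrap_coeff_bound) (rule degree_smult_le)
  also have "\<dots> = c * wrap_coeff n Q t"
    unfolding wrap_coeff_def sum_distrib_left by (rule sum.cong) auto
  finally show ?thesis .
qed

lemma wrap_coeff_sum: "wrap_coeff n (\<Sum>x\<in>A. f x) t = (\<Sum>x\<in>A. wrap_coeff n (f x) t)"
  by (induction A rule: infinite_finite_induct) (auto simp: wrap_coeff_add)

lemma wrap_coeff_monom: "wrap_coeff n (monom c k) t = (if [int k = t] (mod n) then c else 0)"
proof -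
  have "wrap_coeff n (monom c k) t =
      (\<Sum>i\<le>k. if [int i = t] (mod n) then coeff (monom c k) i else 0)"
    by (rule wrap_coeff_bound) (rule degree_monom_le)
  also have "\<dots> = (\<Sum>i\<in>{k}. if [int i = t] (mod n) then coeff (monom c k) i else 0)"
    by (rule sum.mono_neutral_right) auto
  finally show ?thesis by simp
qed

lemma wrap_coeff_cong: "[s = t] (mod n) \<Longrightarrow> wrap_coeff n Q s = wrap_coeff n Q t"
  unfolding wrap_coeff_def by (auto intro!: sum.cong simp: cong_def)

lemma sum_periodic_shift:
  fixes f :: "int \<Rightarrow> 'a :: comm_monoid_add"
  assumes "n > 0" "\<And>x y. [x = y] (mod n) \<Longrightarrow> f x = f y"
  shows "(\<Sum>w\<in>{0..<n}. f (w + c)) = (\<Sum>w\<in>{0..<n}. f w)"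
proof (rule sum.reindex_bij_witness[of _ "\<lambda>w. (w - c) mod n" "\<lambda>w. (w + c) mod n"])
  fix w assume "w \<in> {0..<n}"
  then show "((w + c) mod n - c) mod n = w" "((w - c) mod n + c) mod n = w"
    by (simp_all add: mod_simps)
  show "f ((w + c) mod n) = f (w + c)"
    by (rule assms(2)) (simp add: cong_def)
qed (use assms(1) in auto)

text \<open>Multiplication modulo X^n - 1 is cyclic convolution. By linearity in \<open>P\<close> it
  suffices to treat monomials, which act by shifting the argument.\<close>

lemma wrap_coeff_mult:
  assumes "n > 0"
  shows "wrap_coeff n (P * Q) t = (\<Sum>w\<in>{0..<n}. wrap_coeff n P w * wrap_coeff n Q (t - w))"
proof -
  have m: "wrap_coeff n (monom c k * Q) t = c * wrap_coeff n Q (t - int k)" for c k t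
  proof -
    have "monom c k * Q = (\<Sum>i\<le>degree Q. monom (c * coeff Q i) (k + i))"
      by (subst (1) poly_as_sum_of_monoms[of Q, symmetric])
        (simp add: sum_distrib_left mult_monom)
    then have "wrap_coeff n (monom c k * Q) t =
        (\<Sum>i\<le>degree Q. if [int (k + i) = t] (mod n) then c * coeff Q i else 0)"
      by (simp add: wrap_coeff_sum wrap_coeff_monom)
    also have "\<dots> = c * wrap_coeff n Q (t - int k)"
      unfolding wrap_coeff_def sum_distrib_left
      by (rule sum.cong) (auto simp: cong_iff_dvd_diff algebra_simps)
    finally show ?thesis .
  qed
  have "P * Q = (\<Sum>i\<le>degree P. monom (coeff P i) i * Q)"
    by (subst (1) poly_as_sum_of_monoms[of P, symmetric]) (simp add: sum_distrib_right)
  then have "wrap_coeff n (P * Q) t = (\<Sum>i\<le>degree P. coeff P i * wrap_coeff n Q (t - int i))"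
    by (simp add: wrap_coeff_sum m)
  also have "\<dots> = (\<Sum>i\<le>degree P. \<Sum>w\<in>{0..<n}.
      if [int i = w] (mod n) then coeff P i * wrap_coeff n Q (t - w) else 0)"
  proof (rule sum.cong)
    fix i
    have "(\<Sum>w\<in>{0..<n}. if [int i = w] (mod n) then coeff P i * wrap_coeff n Q (t - w) else 0)
        = (\<Sum>w\<in>{int i mod n}. coeff P i * wrap_coeff n Q (t - w))"
      using assms by (intro sum.mono_neutral_cong_right) (auto simp: cong_def)
    also have "\<dots> = coeff P i * wrap_coeff n Q (t - int i)"
      by (simp, rule disjI2, rule wrap_coeff_cong) (auto simp: cong_def mod_simps)
    finally show "coeff P i * wrap_coeff n Q (t - int i) = (\<Sum>w\<in>{0..<n}.
      if [int i = w] (mod n) then coeff P i * wrap_coeff n Q (t - w) else 0)" by simp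
  qed simp
  also have "\<dots> = (\<Sum>w\<in>{0..<n}. wrap_coeff n P w * wrap_coeff n Q (t - w))"
    by (subst sum.swap) (auto simp: wrap_coeff_def[of n P] sum_distrib_right intro!: sum.cong)
  finally show ?thesis .
qed

text \<open>Modulo \<open>p\<close> the power is the sum of the p-th powers of the monomials, and
  F(x)^p = F(x) for values 0 and 1. The monomial at x thus moves to p x, and folding collects the
  fibre over \<open>t\<close>.\<close>

lemma wrap_coeff_prime_power:
  fixes F :: "int \<Rightarrow> int"
  assumes "n > 0" "prime p" "\<And>x. F x \<in> {0, 1}"
  shows "[wrap_coeff n ((\<Sum>x\<in>{0..<n}. monom (F x) (nat x)) ^ p) t =
      (\<Sum>x | x \<in> {0..<n} \<and> [int p * x = t] (mod n). F x)] (mod int p)"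
proof -
  let ?P = "\<Sum>x\<in>{0..<n}. monom (F x) (nat x)"
  obtain R where R: "?P ^ p - (\<Sum>x\<in>{0..<n}. monom (F x) (nat x) ^ p) = of_nat p * R"
    using freshmans_dream_sum_cong[OF assms(2), of "{0..<n}" "\<lambda>x. monom (F x) (nat x)"]
    by (auto simp: dvd_def)
  have F: "F x ^ p = F x" for x
    using assms(3)[of x] prime_gt_0_nat[OF assms(2)] by auto
  have "?P ^ p = (\<Sum>x\<in>{0..<n}. monom (F x) (nat x * p)) + smult (int p) R"
    using R by (simp add: monom_power F algebra_simps of_nat_poly)
  then have "wrap_coeff n (?P ^ p) t = (\<Sum>x\<in>{0..<n}. if [int (nat x * p) = t] (mod n) then F x else 0)
      + int p * wrap_coeff n R t"
    by (simp add: wrap_coeff_add wrap_coeff_sum wrap_coeff_monom wrap_coeff_smult)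
  moreover have "(\<Sum>x\<in>{0..<n}. if [int (nat x * p) = t] (mod n) then F x else 0)
      = (\<Sum>x | x \<in> {0..<n} \<and> [int p * x = t] (mod n). F x)"
    by (rule sum.mono_neutral_cong_right) (auto simp: mult.commute)
  ultimately show ?thesis by (simp add: cong_def)
qed

section \<open>Invariant functions and Schur's theorems\<close>

text \<open>
  \<open>g False\<close> and \<open>g True\<close> are the permutations of \<open>\<int>/n\<close> induced on the two layers of the
  double cover, as functions on all integers. The flag \<open>c\<close> of an invariant function \<open>F\<close> says whether
  \<open>F\<close> is evaluated at differences between different layers (as for the connection set) or within
  one layer; flags add up under convolution, which is why odd powers preserve the flag.
\<close>

definition perm_pair :: "int \<Rightarrow> (bool \<Rightarrow> int \<Rightarrow> int) \<Rightarrow> bool" where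
  "perm_pair n g \<longleftrightarrow> (\<forall>b x y. [g b x = g b y] (mod n) \<longleftrightarrow> [x = y] (mod n)) \<and>
     (\<forall>b t. \<exists>x. [g b x = t] (mod n))"

definition pair_invariant :: "int \<Rightarrow> (bool \<Rightarrow> int \<Rightarrow> int) \<Rightarrow> bool \<Rightarrow> (int \<Rightarrow> 'b) \<Rightarrow> bool" where
  "pair_invariant n g c F \<longleftrightarrow> (\<forall>x y. [x = y] (mod n) \<longrightarrow> F x = F y) \<and>
     (\<forall>b x y. F (g (b \<noteq> c) y - g b x) = F (y - x))"

lemma perm_pairD:
  assumes "perm_pair n g"
  shows "[g b x = g b y] (mod n) \<longleftrightarrow> [x = y] (mod n)"
  using assms by (simp add: perm_pair_def)

lemma perm_pair_surj:
  assumes "perm_pair n g"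
  obtains x where "[g b x = t] (mod n)"
  using assms unfolding perm_pair_def by blast

lemma pair_invariant_periodic: "pair_invariant n g c F \<Longrightarrow> [x = y] (mod n) \<Longrightarrow> F x = F y"
  unfolding pair_invariant_def by blast

lemma pair_invariant_apply: "pair_invariant n g c F \<Longrightarrow> F (g (b \<noteq> c) y - g b x) = F (y - x)"
  unfolding pair_invariant_def by blast

lemma pair_invariant_comp: "pair_invariant n g c F \<Longrightarrow> pair_invariant n g c (\<lambda>x. h (F x))"
  unfolding pair_invariant_def by metis

lemma pair_invariant_ball:
  "(\<And>i. i \<in> I \<Longrightarrow> pair_invariant n g c (A i)) \<Longrightarrow> pair_invariant n g c (\<lambda>x. \<forall>i\<in>I. A i x)"
  unfolding pair_invariant_def by metis

lemma pair_invariant_zero: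
  assumes "perm_pair n g"
  shows "pair_invariant n g False (\<lambda>t. [t = 0] (mod n))"
proof -
  have "[g b y - g b x = 0] (mod n) \<longleftrightarrow> [y - x = 0] (mod n)" for b x y
    using perm_pairD[OF assms, of b y x] by (simp add: cong_iff_dvd_diff)
  then show ?thesis by (auto simp: pair_invariant_def cong_def)
qed

lemma bij_betw_perm_pair:
  assumes "n > 0" "perm_pair n g"
  shows "bij_betw (\<lambda>v. g b v mod n) {0..<n} {0..<n}"
  unfolding bij_betw_def
proof
  show "inj_on (\<lambda>v. g b v mod n) {0..<n}"
    using perm_pairD[OF assms(2), of b] by (auto simp: inj_on_def cong_def)
  show "(\<lambda>v. g b v mod n) ` {0..<n} = {0..<n}"
  proof (intro equalityI subsetI)
    fix t assume t: "t \<in> {0..<n}"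
    obtain x where "[g b x = t] (mod n)" using assms(2) by (rule perm_pair_surj)
    moreover have "[g b (x mod n) = g b x] (mod n)"
      using perm_pairD[OF assms(2)] by (simp add: cong_def)
    ultimately have "g b (x mod n) mod n = t" using t by (simp add: cong_def)
    then show "t \<in> (\<lambda>v. g b v mod n) ` {0..<n}"
      using assms(1) by (intro image_eqI[of _ _ "x mod n"]) auto
  qed (use assms(1) in auto)
qed

text \<open>Convolution sums over intermediate points. Substituting the permutation of the layer
  reached after the first factor brings both factors into invariant form; layer changes add up
  modulo 2.\<close>

lemma pair_invariant_wrap_coeff_mult:
  assumes n: "n > 0" and g: "perm_pair n g"
    and P: "pair_invariant n g c (wrap_coeff n P)" and Q: "pair_invariant n g c' (wrap_coeff n Q)"
  shows "pair_invariant n g (c \<noteq> c') (wrap_coeff n (P * Q))"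
  unfolding pair_invariant_def
proof (intro conjI allI impI)
  fix b x y
  let ?p = "wrap_coeff n P" and ?q = "wrap_coeff n Q"
  let ?b = "b \<noteq> c"
  let ?y = "g (b \<noteq> (c \<noteq> c')) y" and ?x = "g b x"
  have y: "?y = g (?b \<noteq> c') y" by (cases b; cases c; cases c') simp_all
  have "wrap_coeff n (P * Q) (?y - ?x)
      = (\<Sum>w\<in>{0..<n}. ?p (w + ?x - ?x) * ?q (?y - (w + ?x)))"
    unfolding wrap_coeff_mult[OF n] by (simp add: algebra_simps)
  also have "\<dots> = (\<Sum>w\<in>{0..<n}. ?p (w - ?x) * ?q (?y - w))"
    by (rule sum_periodic_shift[OF n])
      (auto intro!: arg_cong2[of _ _ _ _ "(*)"] wrap_coeff_cong cong_diff)
  also have "\<dots> = (\<Sum>v\<in>{0..<n}. ?p (g ?b v mod n - ?x) * ?q (?y - g ?b v mod n))"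
    by (rule sum.reindex_bij_betw[OF bij_betw_perm_pair[OF n g], symmetric])
  also have "\<dots> = (\<Sum>v\<in>{0..<n}. ?p (g ?b v - ?x) * ?q (?y - g ?b v))"
    by (intro sum.cong arg_cong2[of _ _ _ _ "(*)"] wrap_coeff_cong) (auto simp: cong_def mod_simps)
  also have "\<dots> = (\<Sum>v\<in>{0..<n}. ?p (v - x) * ?q (y - v))"
    unfolding y pair_invariant_apply[OF P] pair_invariant_apply[OF Q] ..
  also have "\<dots> = (\<Sum>v\<in>{0..<n}. ?p (v + x - x) * ?q (y - (v + x)))"
    by (rule sum_periodic_shift[OF n, symmetric])
      (auto intro!: arg_cong2[of _ _ _ _ "(*)"] wrap_coeff_cong cong_diff)
  also have "\<dots> = wrap_coeff n (P * Q) (y - x)"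
    unfolding wrap_coeff_mult[OF n] by (simp add: algebra_simps)
  finally show "wrap_coeff n (P * Q) (?y - ?x) = wrap_coeff n (P * Q) (y - x)" .
qed (rule wrap_coeff_cong)

lemma pair_invariant_wrap_coeff_power:
  assumes n: "n > 0" and g: "perm_pair n g" and P: "pair_invariant n g c (wrap_coeff n P)"
  shows "pair_invariant n g (odd k \<and> c) (wrap_coeff n (P ^ k))"
proof (induction k)
  case 0
  have "wrap_coeff n 1 = (\<lambda>t. if [t = 0] (mod n) then 1 else 0)"
    using wrap_coeff_monom[of n 1 0] by (auto simp: monom_eq_1 cong_def)
  then show ?case using pair_invariant_comp[OF pair_invariant_zero[OF g]] by simp
next
  case (Suc k)
  have "(odd (Suc k) \<and> c) = (c \<noteq> (odd k \<and> c))" by auto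
  then show ?case using pair_invariant_wrap_coeff_mult[OF n g P Suc] by simp
qed

lemma wrap_coeff_indicator:
  assumes n: "n > 0" and "\<And>x y. [x = y] (mod n) \<Longrightarrow> F x = F y"
  shows "wrap_coeff n (\<Sum>x\<in>{0..<n}. monom (F x) (nat x)) t = F t"
proof -
  have "wrap_coeff n (\<Sum>x\<in>{0..<n}. monom (F x) (nat x)) t =
      (\<Sum>x\<in>{0..<n}. if [int (nat x) = t] (mod n) then F x else 0)"
    by (simp add: wrap_coeff_sum wrap_coeff_monom)
  also have "\<dots> = (\<Sum>x\<in>{t mod n}. F x)"
    by (rule sum.mono_neutral_cong_right) (use n in \<open>auto simp: cong_def\<close>)
  also have "\<dots> = F t" by (simp, rule assms(2)) (simp add: cong_def)
  finally show ?thesis .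
qed

text \<open>Schur: raising an invariant element of the group ring to a prime power \<open>p\<close> and reducing
  modulo \<open>p\<close> pushes it forward along multiplication by \<open>p\<close>.\<close>

lemma pair_invariant_push_prime:
  fixes F :: "int \<Rightarrow> int"
  assumes n: "n > 0" and g: "perm_pair n g" and F: "pair_invariant n g c F" and "\<And>x. F x \<in> {0, 1}"
    and p: "prime p"
  shows "pair_invariant n g (odd p \<and> c) (\<lambda>t. (\<Sum>x | x \<in> {0..<n} \<and> [int p * x = t] (mod n). F x) mod int p)"
proof -
  let ?P = "\<Sum>x\<in>{0..<n}. monom (F x) (nat x)"
  have "wrap_coeff n ?P = F"
    using wrap_coeff_indicator[OF n] pair_invariant_periodic[OF F] by blast
  then have "pair_invariant n g (odd p \<and> c) (\<lambda>t. wrap_coeff n (?P ^ p) t mod int p)"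
    using pair_invariant_comp[OF pair_invariant_wrap_coeff_power[OF n g, of c ?P p],
        where h = "\<lambda>z. z mod int p"] F by simp
  then show ?thesis
    using wrap_coeff_prime_power[OF n p assms(4)] by (simp add: cong_def)
qed

text \<open>Since \<open>p\<close> is invertible modulo \<open>n\<close>, the fibre of
  multiplication by \<open>p\<close> over t is the single class of i t, so the push-forward is F(i
  t), and reduction modulo \<open>p\<close> leaves the values 0 and 1 intact. Oddness of
  \<open>p\<close> preserves the flag.\<close>

lemma pair_invariant_dilate_prime:
  fixes F :: "int \<Rightarrow> int"
  assumes n: "n > 0" and g: "perm_pair n g" and F: "pair_invariant n g c F" and F01: "\<And>x. F x \<in> {0, 1}"
    and p: "prime p" "odd p" and i: "[i * int p = 1] (mod n)"
  shows "pair_invariant n g c (\<lambda>t. F (i * t))"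
proof -
  have "(\<Sum>x | x \<in> {0..<n} \<and> [int p * x = t] (mod n). F x) mod int p = F (i * t)" for t
  proof -
    have "{x. x \<in> {0..<n} \<and> [int p * x = t] (mod n)} = {i * t mod n}"
    proof -
      have "[int p * x = t] (mod n) \<longleftrightarrow> [x = i * t] (mod n)" for x
      proof
        assume "[int p * x = t] (mod n)"
        then have *: "[i * (int p * x) = i * t] (mod n)" by (rule cong_scalar_left)
        have "[i * (int p * x) = 1 * x] (mod n)"
          using cong_scalar_right[OF i, of x] by (simp add: mult.assoc)
        from cong_trans[OF cong_sym[OF this] *] show "[x = i * t] (mod n)" by simp
      next
        assume "[x = i * t] (mod n)"
        then have *: "[int p * x = int p * (i * t)] (mod n)" by (rule cong_scalar_left)
        have "[int p * (i * t) = 1 * t] (mod n)"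
          using cong_scalar_right[OF i, of t] by (simp add: ac_simps)
        from cong_trans[OF * this] show "[int p * x = t] (mod n)" by simp
      qed
      then have "{x. x \<in> {0..<n} \<and> [int p * x = t] (mod n)} = {x. x \<in> {0..<n} \<and> [x = i * t] (mod n)}"
        by presburger
      also have "\<dots> = {i * t mod n}" using n by (auto simp: cong_def)
      finally show ?thesis .
    qed
    moreover have "F (i * t mod n) = F (i * t)"
      by (rule pair_invariant_periodic[OF F]) (simp add: cong_def)
    moreover have "F (i * t) mod int p = F (i * t)"
      using F01[of "i * t"] prime_gt_1_nat[OF p(1)] by auto
    ultimately show ?thesis by simp
  qed
  then show ?thesis using pair_invariant_push_prime[OF n g F F01 p(1)] p(2) by simp
qed

text \<open>Dilation by \<open>k\<close> is division by an inverse j of \<open>k\<close>; factoring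
  a positive representative of j into primes reduces this to division by primes.\<close>

lemma pair_invariant_dilate:
  fixes F :: "int \<Rightarrow> int"
  assumes n: "n > 0" "even n" and g: "perm_pair n g" and F: "pair_invariant n g c F" and F01: "\<And>x. F x \<in> {0, 1}"
    and k: "coprime k n"
  shows "pair_invariant n g c (\<lambda>t. F (k * t))"
proof -
  have *: "pair_invariant n g c (\<lambda>t. F (i * t))" if "j > 0" "[i * int j = 1] (mod n)" for i j
    using that
  proof (induction j arbitrary: i rule: less_induct)
    case (less j)
    show ?case
    proof (cases "j = 1")
      case True
      then have "F (i * t) = F t" for t
        using cong_scalar_right[OF less(3), of t] by (intro pair_invariant_periodic[OF F]) auto
      then show ?thesis using F by simp
    next
      case False
      then obtain q where q: "prime q" "q dvd j" using prime_factor_nat by blast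
      then obtain j' where j: "j = q * j'" by (auto simp: dvd_def)
      have "odd q"
      proof
        assume "even q"
        have "2 dvd i * int j - 1"
          using less(3) n(2) by (meson cong_iff_dvd_diff dvd_trans)
        then show False using \<open>even q\<close> j by simp
      qed
      have j': "j' > 0" "j' < j" using less(2) j prime_gt_1_nat[OF q(1)] by auto
      have 1: "[(i * int q) * int j' = 1] (mod n)" using less(3) j by (simp add: ac_simps)
      have 2: "[(i * int j') * int q = 1] (mod n)" using less(3) j by (simp add: ac_simps)
      \<comment> \<open>Here \<open>i * int q\<close> inverts \<open>j'\<close> and
        \<open>i * int j'\<close> inverts \<open>q\<close>; modulo \<open>n\<close> the two
        dilations compose to the one by \<open>i\<close>.\<close>
      have "pair_invariant n g c (\<lambda>t. F ((i * int q) * ((i * int j') * t)))"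
        by (rule pair_invariant_dilate_prime[OF n(1) g less(1)[OF j'(2,1) 1] _ q(1) \<open>odd q\<close> 2])
          (rule F01)
      moreover have "F ((i * int q) * ((i * int j') * t)) = F (i * t)" for t
      proof (rule pair_invariant_periodic[OF F])
        have "[(i * int j) * (i * t) = 1 * (i * t)] (mod n)"
          by (rule cong_scalar_right) (rule less(3))
        then show "[(i * int q) * ((i * int j') * t) = i * t] (mod n)"
          using j by (simp add: ac_simps)
      qed
      ultimately show ?thesis by simp
    qed
  qed
  obtain j where j: "[k * j = 1] (mod n)" using k cong_solve_coprime_int by blast
  \<comment> \<open>A positive representative of the inverse, as the induction runs over positive
    naturals.\<close>
  let ?j = "nat (j mod n + n)"
  have "int ?j = j mod n + n" using n by simp
  then have "[k * int ?j = 1] (mod n)"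
    using j unfolding cong_def by (metis mod_add_self2 mod_mod_trivial mod_mult_right_eq)
  moreover have "?j > 0" using n pos_mod_sign[of n j] by linarith
  ultimately show ?thesis using * by blast
qed

section \<open>Invariant sumsets and the subgroups they generate\<close>

lemma pair_invariant_sumset:
  assumes g: "perm_pair n g" and A: "pair_invariant n g c A" and B: "pair_invariant n g c' B"
  shows "pair_invariant n g (c \<noteq> c') (\<lambda>t. \<exists>w. A w \<and> B (t - w))"
  unfolding pair_invariant_def
proof (intro conjI allI impI)
  fix x y assume xy: "[x = y] (mod n)"
  have "B (x - w) = B (y - w)" for w
    using xy by (intro pair_invariant_periodic[OF B] cong_diff) auto
  then show "(\<exists>w. A w \<and> B (x - w)) = (\<exists>w. A w \<and> B (y - w))" by simp
next
  fix b x y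
  let ?b = "b \<noteq> c"
  let ?y = "g (b \<noteq> (c \<noteq> c')) y" and ?x = "g b x"
  have y: "?y = g (?b \<noteq> c') y" by (cases b; cases c; cases c') simp_all
  have "(\<exists>w. A w \<and> B (?y - ?x - w)) \<longleftrightarrow> (\<exists>u. A (u - ?x) \<and> B (?y - u))"
    by (metis add_diff_cancel_left' diff_add_cancel diff_diff_eq)
  \<comment> \<open>As for convolution, the intermediate point is written as an image under the
    permutation of its layer; surjectivity modulo \<open>n\<close> is enough here.\<close>
  also have "\<dots> \<longleftrightarrow> (\<exists>v. A (g ?b v - ?x) \<and> B (?y - g ?b v))"
  proof
    assume "\<exists>u. A (u - ?x) \<and> B (?y - u)"
    then obtain u where u: "A (u - ?x)" "B (?y - u)" by blast
    obtain v where v: "[g ?b v = u] (mod n)" using g by (rule perm_pair_surj)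
    have "A (g ?b v - ?x) = A (u - ?x)" "B (?y - g ?b v) = B (?y - u)"
      using v by (auto intro!: pair_invariant_periodic[OF A] pair_invariant_periodic[OF B] cong_diff)
    then show "\<exists>v. A (g ?b v - ?x) \<and> B (?y - g ?b v)" using u by blast
  qed blast
  also have "\<dots> \<longleftrightarrow> (\<exists>v. A (v - x) \<and> B (y - v))"
    unfolding y pair_invariant_apply[OF A] pair_invariant_apply[OF B] ..
  also have "\<dots> \<longleftrightarrow> (\<exists>w. A w \<and> B (y - x - w))"
    by (metis add_diff_cancel_left' diff_add_cancel diff_diff_eq)
  finally show "(\<exists>w. A w \<and> B (?y - ?x - w)) = (\<exists>w. A w \<and> B (y - x - w))" .
qed

primrec iterated_sumset :: "int \<Rightarrow> (int \<Rightarrow> bool) \<Rightarrow> nat \<Rightarrow> int \<Rightarrow> bool" where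
  "iterated_sumset n A 0 = (\<lambda>t. [t = 0] (mod n))"
| "iterated_sumset n A (Suc k) = (\<lambda>t. \<exists>w. A w \<and> iterated_sumset n A k (t - w))"

lemma pair_invariant_iterated_sumset:
  assumes "perm_pair n g" "pair_invariant n g c A"
  shows "pair_invariant n g (odd k \<and> c) (iterated_sumset n A k)"
proof (induction k)
  case 0
  then show ?case using pair_invariant_zero[OF assms(1)] by simp
next
  case (Suc k)
  have "(odd (Suc k) \<and> c) = (c \<noteq> (odd k \<and> c))" by auto
  then show ?case using pair_invariant_sumset[OF assms Suc] by simp
qed

text \<open>The induction peels summands off \<open>s\<close>. At length 0 the remaining
  \<open>s\<close> is only congruent to 0, which is where periodicity of the second sumset
  enters.\<close>

lemma iterated_sumset_add:
  "iterated_sumset n A j s \<Longrightarrow> [t' = t] (mod n) \<Longrightarrow> iterated_sumset n A k t \<Longrightarrow>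
    (\<And>x y. [x = y] (mod n) \<Longrightarrow> iterated_sumset n A k x = iterated_sumset n A k y) \<Longrightarrow>
    iterated_sumset n A (j + k) (s + t')"
proof (induction j arbitrary: s)
  case 0
  have "[s + t' = 0 + t] (mod n)" using 0(1,2) by (intro cong_add) auto
  then show ?case using 0(3,4) by simp
next
  case (Suc j)
  then obtain w where "A w" "iterated_sumset n A j (s - w)" by auto
  then show ?case using Suc.IH[of "s - w"] Suc.prems(2-4) by (auto simp: algebra_simps intro!: exI[of _ w])
qed

lemma iterated_sumset_mult: "A y \<Longrightarrow> iterated_sumset n A k (int k * y)"
  by (induction k) (auto simp: algebra_simps intro!: exI[of _ y])

lemma iterated_sumset_dvd:
  assumes "e dvd n" "\<And>t. A t \<Longrightarrow> e dvd t"
  shows "iterated_sumset n A k t \<Longrightarrow> e dvd t"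
proof (induction k arbitrary: t)
  case 0
  then show ?case using assms(1) by (auto simp: cong_0_iff intro: dvd_trans)
next
  case (Suc k)
  then obtain w where "A w" "iterated_sumset n A k (t - w)" by auto
  then have "e dvd w" "e dvd t - w" using Suc.IH assms(2) by auto
  then show ?case by (metis dvd_add diff_add_cancel)
qed

text \<open>Sums of an even number of elements of \<open>A\<close> form a subgroup of the integers
  with generator d. Being invariant with flag \<open>False\<close>, they compare points of one
  layer, so both permutations respect the cosets of d. As 0 lies in \<open>A\<close>, this subgroup
  contains \<open>A\<close>, and d is the greatest common divisor of \<open>A\<close> and
  \<open>n\<close>.\<close>

lemma invariant_generated_divisor:
  assumes n: "n > 0" and g: "perm_pair n g" and A: "pair_invariant n g c A" and A0: "A 0"
  obtains d where "d > 0" "d dvd n" "\<And>t. A t \<Longrightarrow> d dvd t"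
    "\<And>e. e dvd n \<Longrightarrow> (\<And>t. A t \<Longrightarrow> e dvd t) \<Longrightarrow> e dvd d"
    "\<And>b x y. d dvd g b y - g b x \<longleftrightarrow> d dvd y - x"
proof -
  let ?B = "iterated_sumset n A"
  define H where "H = {t. \<exists>k. ?B (2 * k) t}"
  have per: "?B k x = ?B k y" if "[x = y] (mod n)" for k x y
    using pair_invariant_periodic[OF pair_invariant_iterated_sumset[OF g A] that] .
  have add: "?B (j + k) (s + t)" if "?B j s" "?B k t" for j k s t
    using iterated_sumset_add[OF that(1) cong_refl that(2)] per by blast
  have z: "?B 0 0" by simp
  have mult: "?B (i * k) (int i * t)" if "?B k t" for i k t
    by (induction i) (use z add that in \<open>auto simp: algebra_simps\<close>)
  have "n \<in> H" unfolding H_def by (auto intro!: exI[of _ 0] simp: cong_0_iff)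
  moreover have "x - y \<in> H" if xy: "x \<in> H" "y \<in> H" for x y
  proof -
    obtain j k where jk: "?B (2 * j) x" "?B (2 * k) y" using xy by (auto simp: H_def)
    \<comment> \<open>Adding y exactly n - 1 times amounts to subtracting it modulo
      \<open>n\<close>.\<close>
    let ?i = "nat (n - 1)"
    have "?B (2 * j + ?i * (2 * k)) (x + int ?i * y)" by (rule add[OF jk(1) mult[OF jk(2)]])
    moreover have "[x + int ?i * y = x - y] (mod n)"
      using n by (simp add: cong_iff_dvd_diff algebra_simps)
    ultimately have "?B (2 * (j + ?i * k)) (x - y)" using per by (simp add: algebra_simps)
    then show ?thesis unfolding H_def by blast
  qed
  ultimately obtain d where d: "d > 0" "\<And>x. x \<in> H \<longleftrightarrow> d dvd x"
    using additive_set_eq_multiples[OF n] by metis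
  have "d dvd t" if "A t" for t
  proof -
    have 1: "?B (Suc 0) 0" using A0 by (auto intro: exI[of _ 0])
    have "?B (Suc (Suc 0)) t"
      unfolding iterated_sumset.simps(2)[of n A "Suc 0"]
      using 1 that by (auto simp del: iterated_sumset.simps intro: exI[of _ t])
    moreover have "Suc (Suc 0) = 2 * 1" by simp
    ultimately have "?B (2 * 1) t" by metis
    then show ?thesis using d(2) H_def by blast
  qed
  moreover have "e dvd d" if "e dvd n" "\<And>t. A t \<Longrightarrow> e dvd t" for e
  proof -
    have "d \<in> H" using d(2) by simp
    then show ?thesis using iterated_sumset_dvd[OF that] by (auto simp: H_def)
  qed
  moreover have "d dvd g b y - g b x \<longleftrightarrow> d dvd y - x" for b x y
  proof -
    have "?B (2 * k) (g b y - g b x) = ?B (2 * k) (y - x)" for k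
      using pair_invariant_apply[OF pair_invariant_iterated_sumset[OF g A, of "2 * k"], of b y x]
      by simp
    then show ?thesis unfolding d(2)[symmetric] H_def by simp
  qed
  moreover have "d dvd n" using \<open>n \<in> H\<close> d(2) by simp
  ultimately show ?thesis using that d(1) by blast
qed

text \<open>For \<open>A\<close> take the set where the push-forward along multiplication by
  \<open>p\<close> is nonzero modulo \<open>p\<close>. The fibre over p x is a coset of the
  multiples of n/p with at most \<open>p\<close> elements; if \<open>F\<close> is not constant on
  it, the number of ones lies strictly between 0 and \<open>p\<close>.\<close>

lemma invariant_prime_support:
  fixes F :: "int \<Rightarrow> int" and p :: int
  assumes n: "n > 0" and g: "perm_pair n g" and F: "pair_invariant n g c F"
    and F01: "\<And>x. F x \<in> {0, 1}" and p: "prime p" "p dvd n"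
  obtains A where "pair_invariant n g (odd p \<and> c) A" "\<And>t. A t \<Longrightarrow> p dvd t"
    "\<And>x x'. [x = x'] (mod (n div p)) \<Longrightarrow> F x \<noteq> F x' \<Longrightarrow> A (p * x)"
proof -
  have p0: "p > 0" using p(1) prime_gt_0_int by blast
  define r where "r = nat p"
  have r: "prime r" "int r = p" "odd r = odd p"
    using p p0 by (auto simp: r_def even_nat_iff)
  define A where "A t \<longleftrightarrow> (\<Sum>x | x \<in> {0..<n} \<and> [p * x = t] (mod n). F x) mod p \<noteq> 0" for t
  have "pair_invariant n g (odd p \<and> c) A"
    using pair_invariant_comp[OF pair_invariant_push_prime[OF n g F F01 r(1)], of "\<lambda>z. z \<noteq> 0"]
    unfolding A_def r .
  moreover have "p dvd t" if "A t" for t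
  proof -
    obtain x where "[p * x = t] (mod n)"
      using \<open>A t\<close> unfolding A_def by (metis (no_types, lifting) mem_Collect_eq mod_0 sum.neutral)
    then have "[p * x = t] (mod p)" using p(2) cong_dvd_modulus by blast
    then show ?thesis using cong_dvd_iff by fastforce
  qed
  moreover have "A (p * x)" if xx': "[x = x'] (mod (n div p))" "F x \<noteq> F x'" for x x'
  proof -
    define q where "q = n div p"
    have nq: "n = p * q" using p(2) by (simp add: q_def)
    then have q: "q > 0" using n p0 by (simp add: zero_less_mult_iff)
    define C where "C = {z \<in> {0..<n}. [p * z = p * x] (mod n)}"
    have C: "z \<in> C \<longleftrightarrow> z \<in> {0..<n} \<and> [z = x] (mod q)" for z
      using p0 unfolding C_def nq by (auto simp: cong_iff_dvd_diff right_diff_distrib[symmetric])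
    have fin: "finite C" unfolding C_def by (rule finite_subset[of _ "{0..<n}"]) auto
    have "C \<subseteq> (\<lambda>j. x mod q + j * q) ` {0..<p}"
    proof
      fix z assume "z \<in> C"
      then have z: "0 \<le> z" "z < n" "z mod q = x mod q" using C by (auto simp: cong_def)
      have "z div q * q + z mod q < p * q" using z(2) nq by simp
      then have "z div q * q < p * q" using pos_mod_sign[OF q, of z] by linarith
      then have "z div q < p" using q by simp
      moreover have "0 \<le> z div q" using z(1) q by (simp add: pos_imp_zdiv_nonneg_iff)
      moreover have "z = x mod q + (z div q) * q" using z(3) by (metis mod_div_mult_eq)
      ultimately show "z \<in> (\<lambda>j. x mod q + j * q) ` {0..<p}" by auto
    qed
    then have "card C \<le> card {0..<p}" by (rule surj_card_le[rotated]) simp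
    then have cardC: "int (card C) \<le> p" using p0 by simp
    have per: "F (z mod n) = F z" for z by (rule pair_invariant_periodic[OF F]) (simp add: cong_def)
    have mem: "z mod n \<in> C" if "[z = x] (mod q)" for z
      using that n unfolding C nq by (auto simp: cong_def mod_mult2_eq mod_mod_cancel)
    have x: "x mod n \<in> C" "x' mod n \<in> C" using mem xx'(1) by (auto simp: q_def cong_sym)
    obtain u v where uv: "u \<in> C" "v \<in> C" "F u = 0" "F v = 1"
      using x xx'(2) per[of x] per[of x'] F01[of x] F01[of x'] by (metis insertE singletonD)
    have F_bounds: "0 \<le> F z \<and> F z \<le> 1" for z using F01[of z] by auto
    have "sum F C = sum F (C - {u})" using uv(1,3) fin by (simp add: sum.remove)
    also have "\<dots> \<le> (\<Sum>z\<in>C - {u}. 1)" by (rule sum_mono) (use F_bounds in simp)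
    also have "\<dots> < p" using cardC uv(1) fin card_Diff1_less[OF fin uv(1)] by simp
    finally have "sum F C < p" .
    moreover have "sum F C > 0"
    proof -
      have "0 < F v + sum F (C - {v})"
        using sum_nonneg[of "C - {v}" F] F_bounds uv(4) by simp
      then show ?thesis using uv(2) fin by (simp add: sum.remove)
    qed
    ultimately show ?thesis unfolding A_def C_def[symmetric] by simp
  qed
  ultimately show ?thesis using that by blast
qed

section \<open>Constructing the multiplier\<close>

lemma cong_squarefree_iff:
  fixes x y d :: int
  assumes "squarefree d"
  shows "[x = y] (mod d) \<longleftrightarrow> (\<forall>p. prime p \<longrightarrow> p dvd d \<longrightarrow> [x = y] (mod p))"
  using squarefree_dvd_iff[OF assms, of "x - y"] by (simp add: cong_iff_dvd_diff)

lemma even_prime_int_iff: "prime (p :: int) \<Longrightarrow> even p \<longleftrightarrow> p = 2"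
  using primes_dvd_imp_eq[of 2 p] by auto

lemma coprimeI_prime_divisors:
  fixes a n :: int
  assumes "n \<noteq> 0" "\<And>p. prime p \<Longrightarrow> p dvd n \<Longrightarrow> \<not> p dvd a"
  shows "coprime a n"
proof (rule ccontr)
  assume "\<not> coprime a n"
  then have "\<not> is_unit (gcd a n)" by (simp add: coprime_iff_gcd_eq_1)
  moreover have "gcd a n \<noteq> 0" using assms(1) by simp
  ultimately obtain p where "prime p" "p dvd gcd a n" using prime_divisor_exists by blast
  then show False using assms(2)[of p] by simp
qed

text \<open>A prime \<open>q\<close> dominates \<open>p\<close> when \<open>q \<noteq> p\<close> and \<open>q\<close> divides \<open>d p\<close>: the residue of \<open>y\<close> modulo \<open>p\<close>
  is irrelevant for \<open>F\<close> as long as \<open>y\<close> is nonzero modulo such a \<open>q\<close>.\<close>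

lemma eq_if_differences_dominated:
  fixes n :: int and d :: "int \<Rightarrow> int" and F :: "int \<Rightarrow> 'a"
  assumes n: "n > 0" "squarefree n"
    and d: "\<And>p. prime p \<Longrightarrow> p dvd n \<Longrightarrow> d p dvd n"
    and per: "\<And>x y. [x = y] (mod n) \<Longrightarrow> F x = F y"
    and indep: "\<And>p q x x'. prime p \<Longrightarrow> p dvd n \<Longrightarrow> prime q \<Longrightarrow> q dvd d p \<Longrightarrow> q \<noteq> p \<Longrightarrow>
      \<not> q dvd x \<Longrightarrow> [x = x'] (mod (n div p)) \<Longrightarrow> F x = F x'"
    and "\<And>p. prime p \<Longrightarrow> p dvd n \<Longrightarrow> \<not> [y = y'] (mod p) \<Longrightarrow>
      \<exists>q. prime q \<and> q dvd d p \<and> q \<noteq> p \<and> \<not> q dvd y \<and> \<not> q dvd y'"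
  shows "F y = F y'"
proof -
  define D where "D y = {p. prime p \<and> p dvd n \<and> \<not> [y = y'] (mod p)}" for y
  have fin: "finite (D y)" for y
    by (rule finite_subset[of _ "{1..n}"])
      (use n(1) in \<open>auto simp: D_def zdvd_imp_le prime_ge_1_int\<close>)
  have "F y = F y'" if "card (D y) = k"
    "\<And>p. prime p \<Longrightarrow> p dvd n \<Longrightarrow> \<not> [y = y'] (mod p) \<Longrightarrow>
      \<exists>q. prime q \<and> q dvd d p \<and> q \<noteq> p \<and> \<not> q dvd y \<and> \<not> q dvd y'" for k y
    using that
  proof (induction k arbitrary: y)
    case 0
    then have "D y = {}" using fin by simp
    then have "[y = y'] (mod n)" using cong_squarefree_iff[OF n(2)] by (auto simp: D_def)
    then show ?case by (rule per)
  next
    case (Suc k)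
    then obtain p where "p \<in> D y" by (metis card.empty nat.distinct(1) ex_in_conv)
    then have p: "prime p" "p dvd n" "\<not> [y = y'] (mod p)" by (auto simp: D_def)
    obtain q where q: "prime q" "q dvd d p" "q \<noteq> p" "\<not> q dvd y" using Suc.prems(2)[OF p] by blast
    \<comment> \<open>Only the coordinate at \<open>p\<close> is switched from \<open>y\<close> to
      \<open>y'\<close>; \<open>indep\<close> permits this because \<open>q\<close> dominates
      \<open>p\<close>.\<close>
    obtain z where z: "\<And>r. prime r \<Longrightarrow> r dvd n \<Longrightarrow> [z = (if r = p then y' else y)] (mod r)"
      using crt_primes[of n "\<lambda>r. if r = p then y' else y"] n(1) by auto
    have np: "n = p * (n div p)" using p(2) by simp
    have "squarefree (n div p)" using n(2) np by (metis squarefree_mono dvd_triv_right)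
    moreover have "[y = z] (mod r)" if "prime r" "r dvd n div p" for r
    proof -
      have "r dvd n" using that np by (metis dvd_mult)
      moreover have "r \<noteq> p"
      proof
        assume "r = p"
        then have "p ^ 2 dvd n" using that(2) np
          by (metis dvd_refl mult_dvd_mono power2_eq_square)
        then show False using n(2) p(1) squarefreeD not_prime_unit by blast
      qed
      ultimately show ?thesis using z[OF that(1)] by (simp add: cong_sym)
    qed
    ultimately have "[y = z] (mod (n div p))" using cong_squarefree_iff by blast
    then have yz: "F y = F z" using indep[OF p(1,2) q] by blast
    have "[z = y'] (mod r) \<longleftrightarrow> r = p \<or> [y = y'] (mod r)" if "prime r" "r dvd n" for r
    proof (cases "r = p")
      case True
      then show ?thesis using z[OF that] by simp
    next
      case False
      then have "[z = y] (mod r)" using z[OF that] by simp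
      then show ?thesis using False by (simp add: cong_def)
    qed
    then have "D z = D y - {p}" unfolding D_def by blast
    then have card: "card (D z) = k" using \<open>p \<in> D y\<close> Suc.prems(1) fin by simp
    have "F z = F y'"
    proof (rule Suc.IH[OF card])
      fix r assume r: "prime r" "r dvd n" "\<not> [z = y'] (mod r)"
      then have "r \<in> D y" using \<open>D z = D y - {p}\<close> D_def by blast
      then obtain s where s: "prime s" "s dvd d r" "s \<noteq> r" "\<not> s dvd y" "\<not> s dvd y'"
        using Suc.prems(2)[of r] D_def by blast
      have "s dvd n" using s(2) d[OF r(1,2)] dvd_trans by blast
      \<comment> \<open>The coordinate of \<open>z\<close> at \<open>s\<close> comes from
        \<open>y\<close> or \<open>y'\<close>, both nonzero there, so domination passes on to
        \<open>z\<close>.\<close>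
      then have "\<not> s dvd z"
        using s z[OF s(1)] cong_dvd_iff by (metis (full_types))
      then show "\<exists>q. prime q \<and> q dvd d r \<and> q \<noteq> r \<and> \<not> q dvd z \<and> \<not> q dvd y'" using s by blast
    qed
    then show ?case using yz by simp
  qed
  then show ?thesis using assms(6) by blast
qed

text \<open>Residues modulo the primes dividing \<open>n\<close> serve as coordinates. Because
  \<beta> respects the cosets of \<open>d p\<close>, coordinate p of an image depends only on the
  coordinates at primes dividing \<open>d p\<close>. This forces \<beta> to act on sums of
  idempotents as x -> l x + m, up to coordinates that \<open>F\<close> ignores; \<open>inv\<close>
  carries the result to their unit multiples, which exhaust the group.\<close>

lemma multiplier_from_permutation:
  fixes n m :: int and d :: "int \<Rightarrow> int" and F :: "int \<Rightarrow> 'a" and \<beta> :: "int \<Rightarrow> int"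
  assumes n: "n = 2 * m" "odd m" "n > 0" "squarefree n"
    and d: "\<And>p. prime p \<Longrightarrow> p dvd n \<Longrightarrow> p dvd d p \<and> d p dvd n \<and> (odd p \<longrightarrow> d p dvd m)"
    and pres: "\<And>p x y. prime p \<Longrightarrow> p dvd n \<Longrightarrow> d p dvd \<beta> y - \<beta> x \<longleftrightarrow> d p dvd y - x"
    and \<beta>: "\<And>x y. [x = y] (mod n) \<Longrightarrow> [\<beta> x = \<beta> y] (mod n)"
      "[\<beta> 0 = m] (mod n)" "\<And>x. [\<beta> (x + m) = \<beta> x + m] (mod n)"
    and per: "\<And>x y. [x = y] (mod n) \<Longrightarrow> F x = F y"
    and indep: "\<And>p q x x'. prime p \<Longrightarrow> p dvd n \<Longrightarrow> prime q \<Longrightarrow> q dvd d p \<Longrightarrow> q \<noteq> p \<Longrightarrow>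
      \<not> q dvd x \<Longrightarrow> [x = x'] (mod (n div p)) \<Longrightarrow> F x = F x'"
    and inv: "\<And>k y. coprime k n \<Longrightarrow> F (k * \<beta> y) = F (k * y)"
  obtains l where "coprime l n" "\<And>x. F (l * x + m) = F x"
proof -
  have n0: "n \<noteq> 0" using n(3) by simp
  have sqd: "squarefree (d p)" if "prime p" "p dvd n" for p
    using d[OF that] n(4) squarefree_mono by blast
  have m: "p dvd m" if "prime p" "p dvd n" "odd p" for p :: int
    using that n(1) by (simp add: coprime_dvd_mult_right_iff)
  have \<beta>0: "d p dvd \<beta> 0" if "prime p" "p dvd n" "odd p" for p
  proof -
    have "d p dvd m" "d p dvd n" using d that by blast+
    then show ?thesis using \<beta>(2) by (meson cong_dvd_iff cong_dvd_modulus)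
  qed
  have "\<exists>x. \<forall>p. prime p \<longrightarrow> p dvd n \<longrightarrow> [x = (if p \<in> J then 1 else 0)] (mod p)" for J
    by (rule crt_primes[OF n0])
  then obtain e :: "int set \<Rightarrow> int" where
    e: "\<And>J p. prime p \<Longrightarrow> p dvd n \<Longrightarrow> [e J = (if p \<in> J then 1 else 0)] (mod p)" by metis
  have e_dvd: "p dvd e J \<longleftrightarrow> p \<notin> J" if "prime p" "p dvd n" for J p
    using cong_dvd_iff[OF e[OF that, of J]] that(1) by auto
  \<comment> \<open>The default 1, where the image of the idempotent vanishes modulo p, makes
    \<open>l\<close> a unit. At p = 2 it makes \<open>l\<close> odd, and the change of parity is
    left to \<open>m\<close>.\<close>
  define u where "u p = (if p = 2 \<or> p dvd \<beta> (e {p}) then 1 else \<beta> (e {p}))" for p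
  obtain l where l: "\<And>p. prime p \<Longrightarrow> p dvd n \<Longrightarrow> [l = u p] (mod p)"
    using crt_primes[OF n0, of u] by blast
  have l_ndvd: "\<not> p dvd l" if "prime p" "p dvd n" for p
    using cong_dvd_iff[OF l[OF that]] that(1) by (auto simp: u_def)
  have cop: "coprime l n"
  by (rule coprimeI_prime_divisors[OF n0 l_ndvd])
  have "odd l" using l_ndvd[of 2] n(1) by simp
  \<comment> \<open>Stated for general \<open>G\<close> so that it applies to \<open>F\<close>
    dilated by any unit \<open>k\<close>.\<close>
  have core: "G (l * e J + m) = G (e J)"
    if per: "\<And>x y. [x = y] (mod n) \<Longrightarrow> G x = G y"
    and indep: "\<And>p q x x'. prime p \<Longrightarrow> p dvd n \<Longrightarrow> prime q \<Longrightarrow> q dvd d p \<Longrightarrow> q \<noteq> p \<Longrightarrow>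
      \<not> q dvd x \<Longrightarrow> [x = x'] (mod (n div p)) \<Longrightarrow> G x = G x'"
    and G\<beta>: "\<And>y. G (\<beta> y) = G y" for G :: "int \<Rightarrow> 'a" and J
  proof -
    define y where "y = \<beta> (e J)"
    define w where "w = l * e J + m"
    define J' where "J' = {p \<in> J. prime p \<and> p dvd n \<and> odd p}"
    \<comment> \<open>These coordinates are already dominated by the support of \<open>y\<close> and
      can be corrected first.\<close>
    define T where "T p \<longleftrightarrow> p \<in> J' \<and> (\<exists>q. prime q \<and> q dvd d p \<and> q \<noteq> p \<and> \<not> q dvd y)" for p
    have odd_q: "odd q" "q dvd n" if "q dvd d p" "prime p" "p dvd n" "odd p" for p q
      using that d[OF that(2,3)] n(1,2) by (meson dvd_trans dvd_mult)+
    have w_J: "[w = u p] (mod p)" if "p \<in> J'" for p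
    proof -
      have p: "prime p" "p dvd n" "odd p" "p \<in> J" using that by (auto simp: J'_def)
      have "[l * e J + m = u p * 1 + 0] (mod p)"
        using l[OF p(1,2)] e[OF p(1,2), of J] p(4) m[OF p(1-3)]
        by (intro cong_add cong_mult) (auto simp: cong_0_iff)
      then show ?thesis by (simp add: w_def)
    qed
    have w_dvd: "p dvd w \<longleftrightarrow> p \<notin> J" if "prime p" "p dvd n" "odd p" for p
    proof -
      have "p dvd w \<longleftrightarrow> p dvd l * e J"
        unfolding w_def using m[OF that] by (simp add: dvd_add_left_iff)
      then show ?thesis using that l_ndvd e_dvd by (simp add: prime_dvd_mult_iff)
    qed
    \<comment> \<open>Otherwise \<open>y\<close> would vanish modulo \<open>d p\<close>, as the
      image of 0 does; since \<beta> also reflects cosets of \<open>d p\<close>, so would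
      \<open>e J\<close>, although p lies in J.\<close>
    have supp: "\<exists>q. prime q \<and> q dvd d p \<and> \<not> q dvd y" if "p \<in> J'" for p
    proof (rule ccontr)
      assume *: "\<not> ?thesis"
      have p: "prime p" "p dvd n" "odd p" "p \<in> J" using that by (auto simp: J'_def)
      have "d p dvd y" using * squarefree_dvd_iff[OF sqd[OF p(1,2)]] by blast
      then have "d p dvd \<beta> (e J) - \<beta> 0" using \<beta>0[OF p(1-3)] y_def by simp
      then have "d p dvd e J" using pres[OF p(1,2)] by fastforce
      then have "p dvd e J" using d[OF p(1,2)] dvd_trans by blast
      then show False using e_dvd p by blast
    qed
    \<comment> \<open>With no other prime of \<open>J'\<close> in \<open>d p\<close>, the elements
      \<open>e J\<close> and \<open>e {p}\<close> agree modulo \<open>d p\<close>, hence their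
      images agree modulo p. Failure of \<open>T p\<close> leaves p as the only witness in
      \<open>supp\<close>, which excludes the default value of \<open>u\<close>.\<close>
    have free: "[y = u p] (mod p)" if p': "p \<in> J'" and "\<not> T p"
      and no: "\<And>r. r \<in> J' \<Longrightarrow> r \<noteq> p \<Longrightarrow> \<not> r dvd d p" for p
    proof -
      have p: "prime p" "p dvd n" "odd p" "p \<in> J" using p' by (auto simp: J'_def)
      have "\<not> p dvd y" using supp[OF p'] \<open>\<not> T p\<close> p' T_def by blast
      have "q dvd e J - e {p}" if "prime q" "q dvd d p" for q
      proof (cases "q = p")
        case True
        then show ?thesis
          using e[OF p(1,2), of J] e[OF p(1,2), of "{p}"] p(4)
          by (simp add: cong_iff_dvd_diff) (metis dvd_diff diff_diff_eq2 diff_add_cancel)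
      next
        case False
        have "q dvd n" "odd q" using odd_q[OF that(2) p(1-3)] by auto
        then have "q \<notin> J" using no[of q] that False by (auto simp: J'_def)
        then show ?thesis using e_dvd[OF that(1) \<open>q dvd n\<close>] False by (simp add: dvd_diff)
      qed
      then have "d p dvd e J - e {p}" using squarefree_dvd_iff[OF sqd[OF p(1,2)]] by blast
      then have "d p dvd \<beta> (e J) - \<beta> (e {p})" using pres[OF p(1,2)] by blast
      then have *: "[y = \<beta> (e {p})] (mod p)"
        unfolding y_def cong_iff_dvd_diff using d[OF p(1,2)] dvd_trans by blast
      then have "\<not> p dvd \<beta> (e {p})" using \<open>\<not> p dvd y\<close> cong_dvd_iff by blast
      then show ?thesis using * p(3) by (auto simp: u_def)
    qed
    \<comment> \<open>Otherwise \<open>e J\<close> vanishes modulo \<open>d p\<close>, and then so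
      does \<open>y\<close>, since the image of 0 does.\<close>
    have outside: "\<exists>q\<in>J'. q dvd d p" if p: "prime p" "p dvd n" "odd p" "\<not> p dvd y" for p
    proof (rule ccontr)
      assume *: "\<not> ?thesis"
      have "q dvd e J" if "prime q" "q dvd d p" for q
        using * that odd_q[OF that(2) p(1-3)] e_dvd[OF that(1)] by (auto simp: J'_def)
      then have "d p dvd e J - 0" using squarefree_dvd_iff[OF sqd[OF p(1,2)]] by simp
      then have "d p dvd \<beta> (e J) - \<beta> 0" using pres[OF p(1,2)] by blast
      then have "d p dvd y" using \<beta>0[OF p(1-3)] y_def
        by (metis dvd_add diff_add_cancel)
      then show False using p(4) d[OF p(1,2)] dvd_trans by blast
    qed
    \<comment> \<open>If no prime of \<open>J'\<close> divides \<open>d 2\<close>, deleting 2 from J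
      gives an element vanishing modulo \<open>d 2\<close>, whose image is odd like that of 0.
      Adding \<open>m\<close> restores the coordinate at 2 and commutes with \<beta>, so
      \<open>y\<close> and \<open>w\<close> have equal parity.\<close>
    have two: "\<exists>q\<in>J'. q dvd d 2" if "\<not> [y = w] (mod 2)"
    proof (rule ccontr)
      assume *: "\<not> ?thesis"
      have two_n: "prime (2::int)" "2 dvd n" using n(1) by auto
      let ?J = "J - {2}"
      have "q dvd e ?J" if "prime q" "q dvd d 2" for q
      proof -
        have "q dvd n" using that(2) d[OF two_n] dvd_trans by blast
        moreover have "odd q \<or> q = 2" using that(1) even_prime_int_iff by blast
        ultimately show ?thesis using * that e_dvd[OF that(1)] by (auto simp: J'_def)
      qed
      then have "d 2 dvd e ?J - 0" using squarefree_dvd_iff[OF sqd[OF two_n]] by simp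
      then have "d 2 dvd \<beta> (e ?J) - \<beta> 0" using pres[OF two_n] by blast
      then have "even (\<beta> (e ?J) - \<beta> 0)" using d[OF two_n] dvd_trans by blast
      moreover have "odd (\<beta> 0)" using \<beta>(2) n(1,2)
        by (metis cong_dvd_iff cong_dvd_modulus two_n(2))
      ultimately have odd1: "odd (\<beta> (e ?J))" by simp
      have "[e J = e ?J + (if 2 \<in> J then m else 0)] (mod n)"
        unfolding cong_squarefree_iff[OF n(4)]
      proof (intro allI impI)
        fix p :: int assume p: "prime p" "p dvd n"
        show "[e J = e ?J + (if 2 \<in> J then m else 0)] (mod p)"
        proof (cases "p = 2")
          case True
          then show ?thesis using e[OF p, of J] e[OF p, of ?J] n(2)
            by (auto simp: cong_iff_dvd_diff)
        next
          case False
          then have "odd p" using p(1) even_prime_int_iff by blast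
          have "[e J = e ?J] (mod p)"
            using e[OF p, of J] e[OF p, of ?J] False by (simp add: cong_def)
          moreover have "[0 = (if 2 \<in> J then m else 0)] (mod p)"
            using m[OF p \<open>odd p\<close>] by (simp add: cong_0_iff cong_sym_eq[of 0])
          ultimately have "[e J + 0 = e ?J + (if 2 \<in> J then m else 0)] (mod p)"
            by (rule cong_add)
          then show ?thesis by simp
        qed
      qed
      then have "[y = \<beta> (e ?J) + (if 2 \<in> J then m else 0)] (mod n)"
        using \<beta>(1)[of "e J"] cong_trans[OF \<beta>(1)[of "e J" "e ?J + m"] \<beta>(3)[of "e ?J"]]
        unfolding y_def by (auto split: if_splits)
      then have "even y \<longleftrightarrow> even (\<beta> (e ?J) + (if 2 \<in> J then m else 0))"
        using two_n(2) by (meson cong_dvd_iff cong_dvd_modulus)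
      then have "even y \<longleftrightarrow> 2 \<in> J" using odd1 n(2) by auto
      moreover have "even w \<longleftrightarrow> 2 \<in> J"
        unfolding w_def using n(2) \<open>odd l\<close> e_dvd[OF two_n, of J] by auto
      ultimately show False using that by (simp add: cong_iff_dvd_diff)
    qed
    \<comment> \<open>Two passes from \<open>y\<close> to \<open>w\<close>: \<open>y1\<close> corrects the coordinates in \<open>J'\<close> already dominated by the support
      of \<open>y\<close>; afterwards all of \<open>J'\<close> is in the support and dominates what is left.\<close>
    obtain y1 where y1: "\<And>p. prime p \<Longrightarrow> p dvd n \<Longrightarrow> [y1 = (if T p then w else y)] (mod p)"
      using crt_primes[OF n0, of "\<lambda>p. if T p then w else y"] by auto
    \<comment> \<open>Where \<open>T p\<close> holds the coordinate comes from \<open>w\<close>,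
      which is nonzero on \<open>J'\<close>; elsewhere \<open>supp\<close> can only be witnessed by
      p itself, so \<open>y\<close> is nonzero there.\<close>
    have y1_J: "\<not> p dvd y1" if "p \<in> J'" for p
    proof -
      have p: "prime p" "p dvd n" "odd p" "p \<in> J" using that by (auto simp: J'_def)
      have "\<not> p dvd (if T p then w else y)"
        using w_dvd[OF p(1-3)] p(4) supp[OF that] that T_def by auto
      then show ?thesis using cong_dvd_iff[OF y1[OF p(1,2)]] by blast
    qed
    have "G y = G y1"
    proof (rule eq_if_differences_dominated[OF n(3,4) _ per indep])
      fix p assume p: "prime p" "p dvd n" "\<not> [y = y1] (mod p)"
      then have "T p" using y1[OF p(1,2)] by (auto simp: cong_sym split: if_splits)
      then obtain q where q: "prime q" "q dvd d p" "q \<noteq> p" "\<not> q dvd y" unfolding T_def by blast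
      have "p \<in> J'" using \<open>T p\<close> T_def by blast
      then have "q dvd n" "odd q" using odd_q[OF q(2) p(1,2)] by (auto simp: J'_def)
      have "\<not> q dvd y1"
      proof (cases "T q")
        case True
        then show ?thesis using y1_J T_def by blast
      next
        case False
        then show ?thesis using cong_dvd_iff[OF y1[OF q(1) \<open>q dvd n\<close>]] q(4) by simp
      qed
      then show "\<exists>q. prime q \<and> q dvd d p \<and> q \<noteq> p \<and> \<not> q dvd y \<and> \<not> q dvd y1" using q by blast
    qed (use d in blast)
    also have "G y1 = G w"
    proof (rule eq_if_differences_dominated[OF n(3,4) _ per indep])
      fix p assume p: "prime p" "p dvd n" "\<not> [y1 = w] (mod p)"
      then have nT: "\<not> T p" using y1[OF p(1,2)] by auto
      then have y1y: "[y1 = y] (mod p)" using y1[OF p(1,2)] by simp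
      then have yw: "\<not> [y = w] (mod p)" using p(3) cong_trans by blast
      \<comment> \<open>Three cases: for p in \<open>J'\<close>, \<open>free\<close> would otherwise
        give equality of \<open>y\<close> and \<open>w\<close> at p; p = 2 is \<open>two\<close>; at
        an odd p outside J, \<open>w\<close> vanishes and \<open>y\<close> does not, so
        \<open>outside\<close> applies.\<close>
      have "\<exists>q\<in>J'. q dvd d p \<and> q \<noteq> p"
      proof (cases "p \<in> J'")
        case True
        show ?thesis
        proof (rule ccontr)
          assume "\<not> ?thesis"
          then have "[y = u p] (mod p)" using free[OF True nT] by blast
          then show False using yw w_J[OF True] cong_sym cong_trans by blast
        qed
      next
        case False
        show ?thesis
        proof (cases "p = 2")
          case True
          then show ?thesis using two yw False by blast
        next
          case p2: False
          then have "odd p" using p(1) even_prime_int_iff by blast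
          then have "p \<notin> J" using False p by (auto simp: J'_def)
          then have "p dvd w" using w_dvd[OF p(1,2) \<open>odd p\<close>] by simp
          then have "\<not> p dvd y" using yw by (auto simp: cong_iff_dvd_diff dvd_diff)
          then show ?thesis using outside[OF p(1,2) \<open>odd p\<close>] False by blast
        qed
      qed
      then obtain q where q: "q \<in> J'" "q dvd d p" "q \<noteq> p" by blast
      then show "\<exists>q. prime q \<and> q dvd d p \<and> q \<noteq> p \<and> \<not> q dvd y1 \<and> \<not> q dvd w"
        using y1_J[OF q(1)] w_dvd[of q] by (auto simp: J'_def)
    qed (use d in blast)
    finally show ?thesis using G\<beta>[of "e J"] by (simp add: y_def w_def)
  qed
  have "F (l * x + m) = F x" for x
  proof -
    define J where "J = {p. \<not> p dvd x}"
    \<comment> \<open>Filling the zero coordinates of \<open>x\<close> with 1 gives a unit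
      \<open>k\<close> such that \<open>x\<close> is \<open>k * e J\<close> modulo
      \<open>n\<close>.\<close>
    obtain k where k: "\<And>p. prime p \<Longrightarrow> p dvd n \<Longrightarrow> [k = (if p dvd x then 1 else x)] (mod p)"
      using crt_primes[OF n0, of "\<lambda>p. if p dvd x then 1 else x"] by auto
    have k_ndvd: "\<not> p dvd k" if "prime p" "p dvd n" for p
      using cong_dvd_iff[OF k[OF that]] that(1) by auto
    have kn: "coprime k n"
    by (rule coprimeI_prime_divisors[OF n0 k_ndvd])
    have "odd k" using k_ndvd[of 2] n(1) by simp
    have x: "[x = k * e J] (mod n)"
      unfolding cong_squarefree_iff[OF n(4)]
    proof (intro allI impI)
      fix p :: int assume p: "prime p" "p dvd n"
      have "[k * e J = (if p dvd x then 1 else x) * (if p \<in> J then 1 else 0)] (mod p)"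
        by (rule cong_mult[OF k[OF p] e[OF p]])
      moreover have "[(if p dvd x then 1 else x) * (if p \<in> J then 1 else 0) = x] (mod p)"
        by (auto simp: J_def cong_0_iff cong_sym_eq[of 0])
      ultimately show "[x = k * e J] (mod p)" using cong_sym cong_trans by blast
    qed
    have "F (k * (l * e J + m)) = F (k * e J)"
    proof (rule core[of "\<lambda>t. F (k * t)"])
      fix x y assume "[x = y] (mod n)"
      then show "F (k * x) = F (k * y)" by (intro per cong_scalar_left)
    next
      fix p q x x' assume *: "prime p" "p dvd n" "prime q" "q dvd d p" "q \<noteq> p"
        "\<not> q dvd x" "[x = x'] (mod (n div p))"
      have "q dvd n" using *(4) d[OF *(1,2)] dvd_trans by blast
      then have "\<not> q dvd k * x" using *(3,6) k_ndvd by (simp add: prime_dvd_mult_iff)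
      then show "F (k * x) = F (k * x')"
        using indep[OF *(1-5)] cong_scalar_left[OF *(7)] by blast
    qed (rule inv[OF kn])
    moreover have "[k * (l * e J + m) = l * x + m] (mod n)"
    proof -
      have "[l * (k * e J) + k * m = l * x + m] (mod n)"
      proof (intro cong_add cong_scalar_left cong_sym[OF x])
        \<comment> \<open>Since \<open>k\<close> is odd, multiplying \<open>m\<close> by it changes
          nothing modulo 2 m.\<close>
        have "2 * m dvd (k - 1) * m" using \<open>odd k\<close> by (intro mult_dvd_mono) auto
        then show "[k * m = m] (mod n)"
          by (simp add: cong_iff_dvd_diff n(1) algebra_simps)
      qed
      then show ?thesis by (simp add: algebra_simps)
    qed
    ultimately show ?thesis using per x by metis
  qed
  then show ?thesis using that cop by blast
qed

section \<open>The moduli respected by a pair of layer permutations\<close>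

lemma pair_invariant_disj:
  "pair_invariant n g c A \<Longrightarrow> pair_invariant n g c B \<Longrightarrow> pair_invariant n g c (\<lambda>x. A x \<or> B x)"
  unfolding pair_invariant_def by metis

lemma perm_pair_shift:
  assumes "perm_pair n g"
  shows "perm_pair n (\<lambda>b x. g b (x + u) - v)"
  unfolding perm_pair_def
proof (intro conjI allI)
  fix b x y
  show "[g b (x + u) - v = g b (y + u) - v] (mod n) \<longleftrightarrow> [x = y] (mod n)"
    using perm_pairD[OF assms, of b "x + u" "y + u"] by (simp add: cong_iff_dvd_diff)
next
  fix b t
  obtain x where "[g b x = t + v] (mod n)" using assms by (rule perm_pair_surj)
  then show "\<exists>x. [g b (x + u) - v = t] (mod n)"
    by (intro exI[of _ "x - u"]) (simp add: cong_iff_dvd_diff algebra_simps)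
qed

lemma pair_invariant_shift:
  assumes "pair_invariant n g c F"
  shows "pair_invariant n (\<lambda>b x. g b (x + u) - v) c F"
  unfolding pair_invariant_def
proof (intro conjI allI impI)
  fix b x y
  show "F (g (b \<noteq> c) (y + u) - v - (g b (x + u) - v)) = F (y - x)"
    using pair_invariant_apply[OF assms, of b "y + u" "x + u"] by (simp add: algebra_simps)
qed (rule pair_invariant_periodic[OF assms])

text \<open>The m-fold sumset of the support set of \<open>p\<close> keeps the flag
  \<open>True\<close> because \<open>m\<close> is odd. It contains m p x, which is 0 modulo n = 2 m
  because \<open>x\<close> is even.\<close>

lemma pair_invariant_odd_prime_neighbourhood:
  fixes F :: "int \<Rightarrow> int" and p :: int
  assumes n: "n = 2 * m" "odd m" "n > 0" and g: "perm_pair n g" and F: "pair_invariant n g True F"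
    and F01: "\<And>x. F x \<in> {0, 1}" and p: "prime p" "odd p" "p dvd n"
    and x: "even x" "[x = x'] (mod (n div p))" "F x \<noteq> F x'"
  obtains Z where "pair_invariant n g True Z" "Z 0" "\<And>t. Z t \<Longrightarrow> p dvd t"
proof -
  obtain A where A: "pair_invariant n g (odd p \<and> True) A" "\<And>t. A t \<Longrightarrow> p dvd t" "A (p * x)"
    using invariant_prime_support[OF n(3) g F F01 p(1,3)] x(2,3) by metis
  have m0: "m > 0" using n by simp
  let ?Z = "iterated_sumset n A (nat m)"
  have "odd (nat m)" using n(2) m0 by (simp add: even_nat_iff)
  then have Z: "pair_invariant n g True ?Z"
    using pair_invariant_iterated_sumset[OF g A(1), of "nat m"] p(2) by simp
  have "[0 = m * (p * x)] (mod n)"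
    using x(1) n(1) by (simp add: cong_iff_dvd_diff)
  then have "?Z 0" using pair_invariant_periodic[OF Z] iterated_sumset_mult[of A "p * x" n "nat m"] A(3) m0 by simp
  then show ?thesis using that[OF Z] iterated_sumset_dvd[OF p(3) A(2)] by blast
qed

lemma dvd_even_squarefree_half:
  fixes n m t :: int
  assumes "n = 2 * m" "odd m" "squarefree n" "\<And>p. prime p \<Longrightarrow> odd p \<Longrightarrow> p dvd n \<Longrightarrow> p dvd t"
  shows "m dvd t"
proof -
  have "squarefree m" using assms(1,3) by (metis squarefree_mono dvd_triv_right)
  moreover have "p dvd t" if "prime p" "p dvd m" for p
    using assms that by (metis dvd_mult dvd_trans)
  ultimately show ?thesis using squarefree_dvd_iff by blast
qed

text \<open>A multiple of \<open>m\<close> that is not a multiple of 2 m is an odd multiple.\<close>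

lemma cong_half_iff:
  fixes n m t :: int
  assumes "n = 2 * m" "m dvd t" "\<not> n dvd t"
  shows "[t = m] (mod n)"
proof -
  obtain k where k: "t = m * k" using assms(2) by blast
  then have "odd k" using assms(1,3) by (auto simp: mult.commute elim!: evenE)
  then obtain j where "k = 2 * j + 1" by (auto elim: oddE)
  then show ?thesis using k assms(1) by (simp add: cong_iff_dvd_diff algebra_simps)
qed

text \<open>The invariant neighbourhoods of 0 for the odd primes intersect in a set of multiples of
  \<open>m\<close>. It contains the image of 0 in the second layer, which is nonzero modulo
  \<open>n\<close>, so it consists of all multiples of \<open>m\<close>. Enlarging the support set
  of each prime p then yields a modulus \<open>d p\<close> fit for the multiplier
  construction.\<close>

lemma multiplier_from_pair:
  fixes n m :: int and F :: "int \<Rightarrow> int"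
  assumes n: "n = 2 * m" "odd m" "n > 0" "squarefree n"
    and g: "perm_pair n g" and F: "pair_invariant n g True F" and F01: "\<And>x. F x \<in> {0, 1}"
    and aper: "\<And>p. prime p \<Longrightarrow> odd p \<Longrightarrow> p dvd n \<Longrightarrow>
      \<exists>x x'. even x \<and> [x = x'] (mod (n div p)) \<and> F x \<noteq> F x'"
    and g0: "g False 0 = 0" "\<not> [g True 0 = 0] (mod n)"
  obtains l where "coprime l n" "\<And>x. F (l * x + m) = F x"
proof -
  define \<beta> where "\<beta> = g True"
  define \<alpha> where "\<alpha> = g False"
  define P where "P = {p. prime p \<and> odd p \<and> p dvd n}"
  have m: "p dvd m" if "prime p" "p dvd n" "odd p" for p :: int
    using that n(1) by (simp add: coprime_dvd_mult_right_iff)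
  have "\<exists>Z. pair_invariant n g True Z \<and> Z 0 \<and> (\<forall>t. Z t \<longrightarrow> p dvd t)" if "p \<in> P" for p
  proof -
    have p: "prime p" "odd p" "p dvd n" using that by (auto simp: P_def)
    obtain x x' where x: "even x" "[x = x'] (mod (n div p))" "F x \<noteq> F x'" using aper[OF p] by blast
    show ?thesis
    proof (rule pair_invariant_odd_prime_neighbourhood[OF n(1-3) g F F01 p x])
      fix Z assume Z: "pair_invariant n g True Z" "Z 0" "\<And>t. Z t \<Longrightarrow> p dvd t"
      show ?thesis by (rule exI[of _ Z], intro conjI allI impI Z)
    qed
  qed
  then obtain Zp where Zp: "\<And>p. p \<in> P \<Longrightarrow> pair_invariant n g True (Zp p)"
    "\<And>p. p \<in> P \<Longrightarrow> Zp p 0" "\<And>p t. p \<in> P \<Longrightarrow> Zp p t \<Longrightarrow> p dvd t" by metis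
  define Z where "Z t \<longleftrightarrow> (\<forall>p\<in>P. Zp p t)" for t
  have Z: "pair_invariant n g True Z" "Z 0"
    using pair_invariant_ball[of P n g True Zp] Zp unfolding Z_def by blast+
  have Zm: "m dvd t" if "Z t" for t
  proof (rule dvd_even_squarefree_half[OF n(1,2,4)])
    fix p :: int assume "prime p" "odd p" "p dvd n"
    then have "p \<in> P" by (simp add: P_def)
    then show "p dvd t" using Zp(3) that Z_def by blast
  qed
  have Z\<beta>: "Z (\<beta> 0)"
    using pair_invariant_apply[OF Z(1), of False 0 0] Z(2) g0(1) by (simp add: \<beta>_def)
  have \<beta>0: "[\<beta> 0 = m] (mod n)"
    using cong_half_iff[OF n(1) Zm[OF Z\<beta>]] g0(2) by (simp add: \<beta>_def cong_0_iff)
  have "Z m" using Z\<beta> pair_invariant_periodic[OF Z(1) \<beta>0] by simp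
  have Z_iff: "Z t \<longleftrightarrow> m dvd t" for t
  proof
    assume "m dvd t"
    show "Z t"
    proof (cases "n dvd t")
      case True
      then show ?thesis using pair_invariant_periodic[OF Z(1), of t 0] Z(2) by (simp add: cong_0_iff)
    next
      case False
      then show ?thesis
        using pair_invariant_periodic[OF Z(1) cong_half_iff[OF n(1) \<open>m dvd t\<close>]] \<open>Z m\<close> by blast
    qed
  qed (rule Zm)
  then have dm: "pair_invariant n g True (\<lambda>t. m dvd t)" using Z(1) by presburger
  \<comment> \<open>Both images are congruent to \<open>\<alpha> x\<close> modulo \<open>m\<close>,
    yet they are distinct modulo \<open>n\<close>.\<close>
  have \<beta>m: "[\<beta> (x + m) = \<beta> x + m] (mod n)" for x
  proof -
    have "m dvd \<beta> (x + m) - \<alpha> x" "m dvd \<beta> x - \<alpha> x"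
      using pair_invariant_apply[OF dm, of False _ x] by (auto simp: \<alpha>_def \<beta>_def)
    then have "m dvd \<beta> (x + m) - \<beta> x" by (metis dvd_diff diff_diff_eq2 diff_add_cancel)
    moreover have "\<not> n dvd \<beta> (x + m) - \<beta> x"
      using perm_pairD[OF g, of True "x + m" x] n by (simp add: \<beta>_def cong_iff_dvd_diff zdvd_not_zless)
    ultimately show ?thesis
      using cong_half_iff[OF n(1)] by (fastforce simp: cong_iff_dvd_diff algebra_simps)
  qed
  \<comment> \<open>The properties are bundled so that a single choice function \<open>d\<close>
    provides all of them.\<close>
  define good where "good p d \<longleftrightarrow> p dvd d \<and> d dvd n \<and> (odd p \<longrightarrow> d dvd m) \<and>
      (\<forall>b x y. d dvd g b y - g b x \<longleftrightarrow> d dvd y - x) \<and>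
      (\<forall>x x'. [x = x'] (mod (n div p)) \<longrightarrow> F x \<noteq> F x' \<longrightarrow> d dvd p * x)" for p d
  have "\<exists>d. good p d"
    if p: "prime p" "p dvd n" for p
  proof -
    obtain A where A: "pair_invariant n g (odd p \<and> True) A" "\<And>t. A t \<Longrightarrow> p dvd t"
      "\<And>x x'. [x = x'] (mod (n div p)) \<Longrightarrow> F x \<noteq> F x' \<Longrightarrow> A (p * x)"
      using invariant_prime_support[OF n(3) g F F01 p] by metis
    \<comment> \<open>Besides putting 0 into the set, the multiples of \<open>m\<close> force d to
      divide \<open>m\<close> for odd p. For p = 2 the support set has flag \<open>False\<close>,
      which the zero class shares.\<close>
    define A' where "A' t \<longleftrightarrow> A t \<or> (if odd p then m dvd t else [t = 0] (mod n))" for t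
    have "pair_invariant n g (odd p) A'"
      unfolding A'_def using A(1) dm pair_invariant_zero[OF g]
      by (cases "odd p") (auto intro: pair_invariant_disj)
    moreover have "A' 0" by (simp add: A'_def)
    ultimately obtain d where d: "d dvd n" "\<And>t. A' t \<Longrightarrow> d dvd t"
      "\<And>e. e dvd n \<Longrightarrow> (\<And>t. A' t \<Longrightarrow> e dvd t) \<Longrightarrow> e dvd d"
      "\<And>b x y. d dvd g b y - g b x \<longleftrightarrow> d dvd y - x"
      using invariant_generated_divisor[OF n(3) g, of "odd p" A'] by metis
    have "p dvd t" if "A' t" for t
      using that A(2) m[OF p] p(2) unfolding A'_def
      by (auto simp: cong_0_iff split: if_splits intro: dvd_trans)
    then have 1: "p dvd d" using d(3) p(2) by blast
    have 2: "d dvd m" if "odd p" using d(2) that by (simp add: A'_def)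
    have 3: "d dvd p * x" if "[x = x'] (mod (n div p))" "F x \<noteq> F x'" for x x'
      using A(3)[OF that] d(2) by (simp add: A'_def)
    show ?thesis unfolding good_def
      by (intro exI[of _ d] conjI allI impI 1 d(1)) (use 2 3 d(4) in auto)
  qed
  then obtain d where d: "\<And>p. prime p \<Longrightarrow> p dvd n \<Longrightarrow> good p (d p)" by metis
  have d1: "p dvd d p \<and> d p dvd n \<and> (odd p \<longrightarrow> d p dvd m)" if "prime p" "p dvd n" for p
    using d[OF that] by (simp add: good_def)
  have d2: "d p dvd g b y - g b x \<longleftrightarrow> d p dvd y - x" if "prime p" "p dvd n" for p b x y
    using d[OF that] by (simp add: good_def)
  have d3: "d p dvd p * x" if "prime p" "p dvd n" "[x = x'] (mod (n div p))" "F x \<noteq> F x'" for p x x'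
    using d[OF that(1,2)] that(3,4) by (simp add: good_def)
  show ?thesis
  proof (rule multiplier_from_permutation[OF n d1 _ _ \<beta>0 \<beta>m pair_invariant_periodic[OF F]])
    fix p q x x' :: int
    assume *: "prime p" "p dvd n" "prime q" "q dvd d p" "q \<noteq> p" "\<not> q dvd x" "[x = x'] (mod (n div p))"
    show "F x = F x'"
    proof (rule ccontr)
      assume "F x \<noteq> F x'"
      then have "q dvd p * x" using d3[OF *(1,2,7)] *(4) dvd_trans by blast
      then show False using *(1,3,5,6) by (auto simp: prime_dvd_mult_iff dest: primes_dvd_imp_eq)
    qed
  next
    fix k y assume "coprime k n"
    then have "pair_invariant n g True (\<lambda>t. F (k * t))"
      using pair_invariant_dilate[OF n(3) _ g F F01] n(1) by simp
    from pair_invariant_apply[OF this, of False y 0] show "F (k * \<beta> y) = F (k * y)"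
      using g0(1) by (simp add: \<beta>_def)
  next
    fix x y :: int assume "[x = y] (mod n)"
    then show "[\<beta> x = \<beta> y] (mod n)" using perm_pairD[OF g] by (simp add: \<beta>_def)
  next
    fix p x y :: int assume "prime p" "p dvd n"
    then show "d p dvd \<beta> y - \<beta> x \<longleftrightarrow> d p dvd y - x" unfolding \<beta>_def by (rule d2)
  qed (use that in auto)
qed

section \<open>Automorphisms of the double cover\<close>

lemma mod_mem_Zn: "n > 0 \<Longrightarrow> x mod int n \<in> Zn n"
  by (simp add: Zn_def)

lemma mod_Zn: "x \<in> Zn n \<Longrightarrow> x mod int n = x"
  by (simp add: Zn_def)

lemma finite_Zn: "finite (Zn n)"
  by (simp add: Zn_def)

lemma pverts_Cay: "pverts (Cay n S) = Zn n"
  by (simp add: Cay_def)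

lemma parcs_Cay: "(x, y) \<in> parcs (Cay n S) \<longleftrightarrow> x \<in> Zn n \<and> y \<in> Zn n \<and> (y - x) mod int n \<in> S"
  by (simp add: Cay_def)

lemma pverts_double_cover: "pverts (tensor_product (Cay n S) K2) = Zn n \<times> {0, 1}"
  by (simp add: tensor_product_def K2_def Cay_def)

lemma parcs_double_cover: "((x, i), (y, j)) \<in> parcs (tensor_product (Cay n S) K2) \<longleftrightarrow>
    x \<in> Zn n \<and> y \<in> Zn n \<and> (y - x) mod int n \<in> S \<and> (i = 0 \<and> j = 1 \<or> i = 1 \<and> j = 0)"
  by (auto simp: tensor_product_def K2_def Cay_def)

lemma minus_mod_mem_iff:
  assumes "n > 0" "S \<subseteq> Zn n" "S = dilate n (- 1) S"
  shows "(- t) mod int n \<in> S \<longleftrightarrow> t mod int n \<in> S"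
proof -
  have *: "(- s) mod int n \<in> S" if "s \<in> S" for s
  proof -
    have "((- 1) * s) mod int n \<in> dilate n (- 1) S" unfolding dilate_def using that by (rule imageI)
    then show ?thesis using assms(3) by simp
  qed
  show ?thesis using *[of "t mod int n"] *[of "(- t) mod int n"] by (auto simp: mod_simps)
qed

lemma constant_if_connected:
  assumes "Digraph_Component.connected (with_proj G)"
    and "\<And>x y. (x, y) \<in> parcs G \<Longrightarrow> Q x = Q y" and "u \<in> pverts G" "v \<in> pverts G"
  shows "Q u = Q v"
proof -
  have "(u, v) \<in> rtrancl_on (pverts G) (parcs (mk_symmetric (with_proj G)))"
    using assms(1,3,4)
    by (simp add: Digraph_Component.connected_def strongly_connected_def reachable_def)
  then show ?thesis
  proof (induction rule: rtrancl_on_induct)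
    case (step y z)
    then have "(y, z) \<in> parcs G \<or> (z, y) \<in> parcs G" by (auto simp: parcs_mk_symmetric)
    then show ?case using step.IH assms(2) by metis
  qed simp
qed

text \<open>Whether a vertex (x, i) keeps its layer is constant along arcs of the double cover. If
  the answers for (x, 0) and (x, 1) differed at one x, connectedness would make them differ at every
  x, and the answer in layer 0 would be a 2-colouring of the graph.\<close>

lemma double_cover_automorphism_layers:
  assumes n: "n > 0" and sym: "\<And>t. (- t) mod int n \<in> S \<longleftrightarrow> t mod int n \<in> S"
    and conn: "Digraph_Component.connected (with_proj (Cay n S))" and nb: "\<not> bipartite (Cay n S)"
    and f: "f \<in> Aut (tensor_product (Cay n S) K2)"
  obtains c where "\<And>x i. x \<in> Zn n \<Longrightarrow> i \<in> {0, 1} \<Longrightarrow> snd (f (x, i)) = (if c then i else 1 - i)"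
proof -
  let ?B = "tensor_product (Cay n S) K2"
  have fV: "f (x, i) \<in> Zn n \<times> {0, 1}" if "x \<in> Zn n" "i \<in> {0, 1}" for x i
    using f that by (auto simp: Aut_def Bij_def bij_betw_def pverts_double_cover)
  have arc: "(f (x, i), f (y, j)) \<in> parcs ?B"
    if "(x, y) \<in> parcs (Cay n S)" "i = 0 \<and> j = 1 \<or> i = 1 \<and> j = 0" for x y i j
    using f that by (auto simp: Aut_def pverts_double_cover parcs_double_cover parcs_Cay)
  define k where "k x i \<longleftrightarrow> snd (f (x, i)) = i" for x and i :: nat
  have k: "k x i = k y j" if "(x, y) \<in> parcs (Cay n S)" "i = 0 \<and> j = 1 \<or> i = 1 \<and> j = 0" for x y i j
    using arc[OF that] that(2) parcs_double_cover[of "fst (f (x, i))" "snd (f (x, i))" "fst (f (y, j))" "snd (f (y, j))"]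
    by (auto simp: k_def)
  have z: "0 \<in> Zn n" using n by (simp add: Zn_def)
  have loc: "(k x 0 = k x 1) = (k y 0 = k y 1)" if "(x, y) \<in> parcs (Cay n S)" for x y
    using k[OF that, of 0 1] k[OF that, of 1 0] by auto
  have eq: "(k x 0 = k x 1) = (k 0 0 = k 0 1)" if "x \<in> Zn n" for x
    by (rule constant_if_connected[OF conn loc]) (use that z in \<open>auto simp: pverts_Cay\<close>)
  have "k 0 0 = k 0 1"
  proof (rule ccontr)
    assume *: "k 0 0 \<noteq> k 0 1"
    let ?X = "{x \<in> Zn n. k x 0}"
    have "k x 0 \<noteq> k y 0" if "(x, y) \<in> parcs (Cay n S)" for x y
    proof -
      have "y \<in> Zn n" using that by (simp add: parcs_Cay)
      then show ?thesis using eq[of y] * k[OF that, of 0 1] by auto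
    qed
    then have "bipartite (Cay n S)"
      unfolding bipartite_def
      by (intro exI[of _ ?X] exI[of _ "Zn n - ?X"]) (auto simp: pverts_Cay, auto simp: parcs_Cay)
    then show False using nb by blast
  qed
  then have both: "k x 1 = k x 0" if "x \<in> Zn n" for x using eq[OF that] by blast
  have "k x 0 = k 0 0" if "x \<in> Zn n" for x
  proof (rule constant_if_connected[OF conn])
    fix x y assume xy: "(x, y) \<in> parcs (Cay n S)"
    then have "y \<in> Zn n" by (simp add: parcs_Cay)
    then show "k x 0 = k y 0" using k[OF xy, of 0 1] both by auto
  qed (use that z in \<open>auto simp: pverts_Cay\<close>)
  then have "k x i = k 0 0" if "x \<in> Zn n" "i \<in> {0, 1}" for x i
    using both that by auto
  then have "snd (f (x, i)) = (if k 0 0 then i else 1 - i)" if "x \<in> Zn n" "i \<in> {0, 1}" for x i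
    using fV[OF that] that by (auto simp: k_def mem_Times_iff)
  then show ?thesis using that by blast
qed

lemma product_automorphism:
  assumes "\<phi> \<in> Aut (Cay n S)" "\<psi> \<in> Aut K2"
  shows "restrict (map_prod \<phi> \<psi>) (Zn n \<times> {0, 1}) \<in> Aut (tensor_product (Cay n S) K2)"
proof -
  let ?f = "restrict (map_prod \<phi> \<psi>) (Zn n \<times> {0, 1})"
  have b: "bij_betw \<phi> (Zn n) (Zn n)" "bij_betw \<psi> {0, 1} {0, 1}"
    using assms by (auto simp: Aut_def Bij_def pverts_Cay K2_def)
  have arc1: "(\<phi> x, \<phi> y) \<in> parcs (Cay n S) \<longleftrightarrow> (x, y) \<in> parcs (Cay n S)" if "x \<in> Zn n" "y \<in> Zn n" for x y
    using assms(1) that by (simp add: Aut_def pverts_Cay)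
  have arc2: "(\<psi> i, \<psi> j) \<in> parcs K2 \<longleftrightarrow> (i, j) \<in> parcs K2" if "i \<in> {0, 1}" "j \<in> {0, 1}" for i j
  proof -
    have "i \<in> pverts K2" "j \<in> pverts K2" using that by (auto simp: K2_def)
    then show ?thesis using assms(2) by (simp add: Aut_def)
  qed
  have "bij_betw (map_prod \<phi> \<psi>) (Zn n \<times> {0, 1}) (Zn n \<times> {0, 1})"
    by (rule bij_betw_map_prod[OF b])
  then have "bij_betw ?f (Zn n \<times> {0, 1}) (Zn n \<times> {0, 1})"
    by (simp only: bij_betw_restrict_eq)
  then have "?f \<in> Bij (Zn n \<times> {0, 1})"
    unfolding Bij_def by (intro IntI restrict_extensional CollectI)
  moreover have "(?f u, ?f v) \<in> parcs (tensor_product (Cay n S) K2) \<longleftrightarrow> (u, v) \<in> parcs (tensor_product (Cay n S) K2)"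
    if "u \<in> Zn n \<times> {0, 1}" "v \<in> Zn n \<times> {0, 1}" for u v
    using that arc1 arc2 by (cases u; cases v) (simp add: tensor_product_def)
  ultimately show ?thesis unfolding Aut_def pverts_double_cover by blast
qed

text \<open>An automorphism that is not a product still preserves or exchanges whole layers. If its
  two maps \<open>h\<close> on first coordinates coincided, it would be a product after all.\<close>

lemma layered_automorphism_if_unstable:
  assumes n: "n > 0" and sym: "\<And>t. (- t) mod int n \<in> S \<longleftrightarrow> t mod int n \<in> S"
    and conn: "Digraph_Component.connected (with_proj (Cay n S))" and nb: "\<not> bipartite (Cay n S)"
    and unst: "unstable (Cay n S)"
  obtains h :: "bool \<Rightarrow> int \<Rightarrow> int" and x where
    "\<And>b. bij_betw (h b) (Zn n) (Zn n)"
    "\<And>b x y. x \<in> Zn n \<Longrightarrow> y \<in> Zn n \<Longrightarrow> (h (\<not> b) y - h b x) mod int n \<in> S \<longleftrightarrow> (y - x) mod int n \<in> S"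
    "x \<in> Zn n" "h False x \<noteq> h True x"
proof -
  let ?B = "tensor_product (Cay n S) K2"
  let ?V = "Zn n \<times> {0, 1 :: nat}"
  let ?I = "(\<lambda>(\<phi>, \<psi>). restrict (map_prod \<phi> \<psi>) ?V) ` (Aut (Cay n S) \<times> Aut K2)"
  have "?I \<subseteq> Aut ?B" using product_automorphism by auto
  moreover have "Aut ?B \<noteq> ?I" using unst by (simp add: stable_def pverts_Cay K2_def)
  ultimately obtain f where f: "f \<in> Aut ?B" "f \<notin> ?I" by blast
  obtain c where c: "\<And>x i. x \<in> Zn n \<Longrightarrow> i \<in> {0, 1} \<Longrightarrow> snd (f (x, i)) = (if c then i else 1 - i)"
    using double_cover_automorphism_layers[OF n sym conn nb f(1)] by blast
  have fb: "bij_betw f ?V ?V" "f \<in> extensional ?V"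
    using f(1) by (auto simp: Aut_def Bij_def pverts_double_cover)
  define h where "h b x = fst (f (x, if b then 1 else 0))" for b x
  have f_eq: "f (x, if b then 1 else 0) = (h b x, if c = b then 1 else 0)" if "x \<in> Zn n" for b x
    using c[OF that, of "if b then 1 else 0"] by (auto simp: h_def prod_eq_iff)
  have hZ: "h b x \<in> Zn n" if "x \<in> Zn n" for b x
    using bij_betw_apply[OF fb(1), of "(x, if b then 1 else 0)"] that f_eq[OF that] by auto
  have bij: "bij_betw (h b) (Zn n) (Zn n)" for b
  proof -
    have "inj_on (h b) (Zn n)"
    proof (rule inj_onI)
      fix x y assume xy: "x \<in> Zn n" "y \<in> Zn n" "h b x = h b y"
      then have "f (x, if b then 1 else 0) = f (y, if b then 1 else 0)" by (simp only: f_eq)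
      then show "x = y"
        using inj_onD[OF bij_betw_imp_inj_on[OF fb(1)], of "(x, if b then 1 else 0)" "(y, if b then 1 else 0)"] xy by auto
    qed
    moreover have "h b ` Zn n \<subseteq> Zn n" using hZ by blast
    ultimately show ?thesis using endo_inj_surj[OF finite_Zn] by (auto simp: bij_betw_def)
  qed
  have adj: "(h (\<not> b) y - h b x) mod int n \<in> S \<longleftrightarrow> (y - x) mod int n \<in> S"
    if xy: "x \<in> Zn n" "y \<in> Zn n" for b x y
  proof -
    let ?i = "if b then 1 else 0 :: nat" and ?j = "if \<not> b then 1 else 0 :: nat"
    have 1: "(f (x, ?i), f (y, ?j)) \<in> parcs ?B \<longleftrightarrow> ((x, ?i), (y, ?j)) \<in> parcs ?B"
      using f(1) xy by (simp add: Aut_def pverts_double_cover)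
    have 2: "((x, ?i), (y, ?j)) \<in> parcs ?B \<longleftrightarrow> (y - x) mod int n \<in> S"
      using xy by (cases b) (simp_all add: parcs_double_cover)
    have 3: "((h b x, if c = b then 1 else 0), (h (\<not> b) y, if c = (\<not> b) then 1 else 0)) \<in> parcs ?B
        \<longleftrightarrow> (h (\<not> b) y - h b x) mod int n \<in> S"
      using hZ[OF xy(1)] hZ[OF xy(2)] by (cases b; cases c) (simp_all add: parcs_double_cover)
    show ?thesis
      using 1 unfolding f_eq[OF xy(1), of b] f_eq[OF xy(2), of "\<not> b"] 2 3 .
  qed
  have "\<exists>x\<in>Zn n. h False x \<noteq> h True x"
  proof (rule ccontr)
    assume "\<not> ?thesis"
    then have same: "h True x = h False x" if "x \<in> Zn n" for x using that by auto
    define \<phi> where "\<phi> = restrict (h False) (Zn n)"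
    define \<psi> where "\<psi> = restrict (\<lambda>i. if c then i else 1 - i) {0, 1 :: nat}"
    have "\<phi> \<in> Aut (Cay n S)"
    proof -
      have "bij_betw \<phi> (Zn n) (Zn n)"
        using bij[of False] by (simp add: \<phi>_def cong: bij_betw_cong)
      then have "\<phi> \<in> Bij (Zn n)" by (simp add: Bij_def \<phi>_def)
      moreover have "(\<phi> x, \<phi> y) \<in> parcs (Cay n S) \<longleftrightarrow> (x, y) \<in> parcs (Cay n S)"
        if "x \<in> Zn n" "y \<in> Zn n" for x y
        using adj[OF that, of False] same[OF that(2)] hZ[OF that(1)] hZ[OF that(2)] that
        by (simp add: parcs_Cay \<phi>_def)
      ultimately show ?thesis by (simp add: Aut_def pverts_Cay)
    qed
    moreover have "\<psi> \<in> Aut K2"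
      by (cases c) (auto simp: Aut_def Bij_def K2_def \<psi>_def bij_betw_def inj_on_def)
    moreover have "f = restrict (map_prod \<phi> \<psi>) ?V"
    proof (rule extensionalityI[OF fb(2)])
      fix v assume v: "v \<in> ?V"
      obtain x i where xi: "v = (x, i)" "x \<in> Zn n" "i = 0 \<or> i = 1" using v by auto
      then show "f v = restrict (map_prod \<phi> \<psi>) ?V v"
        using f_eq[OF xi(2), of False] f_eq[OF xi(2), of True] same[OF xi(2)]
        by (auto simp: \<phi>_def \<psi>_def)
    qed simp
    ultimately show False using f(2) by (auto intro!: image_eqI[of _ _ "(\<phi>, \<psi>)"])
  qed
  then show ?thesis using that bij adj by blast
qed

text \<open>A product map moves first coordinates in the same way in both layers, which fails at
  \<open>z\<close>. Symmetry of S allows \<open>adj\<close> to be read in both directions.\<close>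

lemma unstable_if_layered_automorphism:
  assumes "\<And>t. (- t) mod int n \<in> S \<longleftrightarrow> t mod int n \<in> S"
    and "bij_betw \<alpha> (Zn n) (Zn n)" "bij_betw \<beta> (Zn n) (Zn n)"
    and adj: "\<And>x y. x \<in> Zn n \<Longrightarrow> y \<in> Zn n \<Longrightarrow> (\<beta> y - \<alpha> x) mod int n \<in> S \<longleftrightarrow> (y - x) mod int n \<in> S"
    and "z \<in> Zn n" "\<alpha> z \<noteq> \<beta> z"
  shows "unstable (Cay n S)"
proof
  let ?B = "tensor_product (Cay n S) K2"
  let ?V = "Zn n \<times> {0, 1 :: nat}"
  define f where "f = restrict (\<lambda>(x, i). (if i = 0 then \<alpha> x else \<beta> x, i)) ?V"
  have Z: "\<alpha> x \<in> Zn n" "\<beta> x \<in> Zn n" if "x \<in> Zn n" for x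
    using that assms(2,3) by (auto dest: bij_betw_apply)
  have adj': "(\<alpha> y - \<beta> x) mod int n \<in> S \<longleftrightarrow> (y - x) mod int n \<in> S" if "x \<in> Zn n" "y \<in> Zn n" for x y
    using adj[OF that(2,1)] assms(1)[of "\<alpha> y - \<beta> x"] assms(1)[of "y - x"] by simp
  have inj: "inj_on f ?V"
    using bij_betw_imp_inj_on[OF assms(2)] bij_betw_imp_inj_on[OF assms(3)]
    by (auto simp: inj_on_def f_def)
  moreover have "f ` ?V \<subseteq> ?V" using Z by (auto simp: f_def)
  moreover have "finite ?V" by (simp add: finite_Zn)
  ultimately have "f ` ?V = ?V" using endo_inj_surj by blast
  then have "f \<in> Bij ?V" using inj by (simp add: Bij_def bij_betw_def f_def)
  moreover have "(f u, f v) \<in> parcs ?B \<longleftrightarrow> (u, v) \<in> parcs ?B" if "u \<in> ?V" "v \<in> ?V" for u v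
    using that adj adj' Z by (cases u; cases v) (auto simp: f_def parcs_double_cover)
  ultimately have "f \<in> Aut ?B" unfolding Aut_def pverts_double_cover by blast
  moreover assume "stable (Cay n S)"
  ultimately obtain \<phi> \<psi> where f: "f = restrict (map_prod \<phi> \<psi>) ?V"
    by (auto simp: stable_def pverts_Cay K2_def)
  have "f (z, 0) = (\<phi> z, \<psi> 0)" "f (z, 1) = (\<phi> z, \<psi> 1)" using f assms(5) by simp_all
  then show False using assms(5,6) by (auto simp: f_def)
qed

section \<open>The two conditions\<close>

lemma even_Zn_iff:
  assumes "n > 0" "even n"
  shows "x \<in> even_Zn n \<longleftrightarrow> x \<in> Zn n \<and> even x"
proof
  assume "x \<in> even_Zn n"
  then show "x \<in> Zn n \<and> even x"
    using assms mod_mem_Zn[OF assms(1)] by (auto simp: even_Zn_def dvd_mod_iff)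
next
  assume x: "x \<in> Zn n \<and> even x"
  then obtain y where "x = 2 * y" by (auto elim: evenE)
  then show "x \<in> even_Zn n"
    using x by (auto simp: even_Zn_def Zn_def intro!: image_eqI[of _ _ y])
qed

lemma translate_even_part_eqI:
  assumes n: "n > 0" "even n" and h: "even h" and S: "S \<subseteq> Zn n"
    and per: "\<And>t. even t \<Longrightarrow> (t + h) mod int n \<in> S \<longleftrightarrow> t mod int n \<in> S"
  shows "translate n (S \<inter> even_Zn n) h = S \<inter> even_Zn n"
proof (intro equalityI subsetI)
  fix t assume "t \<in> translate n (S \<inter> even_Zn n) h"
  then obtain s where s: "s \<in> S" "s \<in> Zn n" "even s" "t = (s + h) mod int n"
    by (auto simp: translate_def even_Zn_iff[OF n])
  then have "t \<in> S" using per[of s] mod_Zn by simp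
  moreover have "even t" using s(3,4) h n by (simp add: dvd_mod_iff)
  ultimately show "t \<in> S \<inter> even_Zn n" using S even_Zn_iff[OF n] by blast
next
  fix t assume "t \<in> S \<inter> even_Zn n"
  then have t: "t \<in> S" "t \<in> Zn n" "even t" by (auto simp: even_Zn_iff[OF n])
  let ?s = "(t - h) mod int n"
  have "?s \<in> S" using per[of "t - h"] t h mod_Zn by simp
  moreover have "even ?s" using t h n by (simp add: dvd_mod_iff)
  moreover have "t = (?s + h) mod int n" using mod_Zn[OF t(2)] by (simp add: mod_simps)
  ultimately show "t \<in> translate n (S \<inter> even_Zn n) h"
    using S even_Zn_iff[OF n] unfolding translate_def by blast
qed

lemma translate_even_part_eqD:
  assumes n: "n > 0" "even n" and h: "even h"
    and eq: "translate n (S \<inter> even_Zn n) h = S \<inter> even_Zn n" and t: "even t"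
  shows "(t + h) mod int n \<in> S \<longleftrightarrow> t mod int n \<in> S"
proof
  assume "t mod int n \<in> S"
  moreover have "t mod int n \<in> even_Zn n" using t n mod_mem_Zn by (simp add: even_Zn_iff[OF n] dvd_mod_iff)
  ultimately have "(t mod int n + h) mod int n \<in> translate n (S \<inter> even_Zn n) h"
    unfolding translate_def by blast
  then show "(t + h) mod int n \<in> S" using eq by (simp add: mod_simps)
next
  assume "(t + h) mod int n \<in> S"
  moreover have "(t + h) mod int n \<in> even_Zn n"
    using t h n mod_mem_Zn by (simp add: even_Zn_iff[OF n] dvd_mod_iff)
  ultimately have "(t + h) mod int n \<in> translate n (S \<inter> even_Zn n) h" using eq by blast
  then obtain s where s: "s \<in> S" "s \<in> Zn n" "(t + h) mod int n = (s + h) mod int n"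
    by (auto simp: translate_def even_Zn_iff[OF n])
  then have "t mod int n = s mod int n" by (metis add_diff_cancel_right' mod_diff_left_eq)
  then show "t mod int n \<in> S" using s mod_Zn by simp
qed

lemma bij_betw_Zn_add:
  assumes "n > 0"
  shows "bij_betw (\<lambda>x. (x + c) mod int n) (Zn n) (Zn n)"
  by (rule bij_betw_byWitness[of _ "\<lambda>x. (x - c) mod int n"])
    (use assms in \<open>auto simp: mod_simps mod_Zn mod_mem_Zn\<close>)

lemma bij_betw_Zn_shift_parity:
  assumes n: "n > 0" "even n" and h: "even h"
  shows "bij_betw (\<lambda>x. if even x = b then (x + h) mod int n else x) (Zn n) (Zn n)"
proof -
  have e: "even (t mod int n) \<longleftrightarrow> even t" for t using n by (simp add: dvd_mod_iff)
  show ?thesis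
    by (rule bij_betw_byWitness[of _ "\<lambda>x. if even x = b then (x - h) mod int n else x"])
      (use n h in \<open>auto simp: mod_simps mod_Zn mod_mem_Zn e\<close>)
qed

text \<open>Shift the even points of layer 0 and the odd points of layer 1 by \<open>h\<close>.
  Between points of different parity both ends move or neither does; between points of equal parity
  the even difference changes by \<open>h\<close> up to sign, which the period absorbs.\<close>

lemma unstable_if_even_part_periodic:
  assumes n: "n > 0" "even n" and sym: "\<And>t. (- t) mod int n \<in> S \<longleftrightarrow> t mod int n \<in> S"
    and h: "h \<in> even_Zn n" "h \<noteq> 0" and eq: "translate n (S \<inter> even_Zn n) h = S \<inter> even_Zn n"
  shows "unstable (Cay n S)"
proof (rule unstable_if_layered_automorphism[OF sym])
  have hZ: "h \<in> Zn n" "even h" using h(1) even_Zn_iff[OF n] by auto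
  let ?a = "\<lambda>x. if even x = True then (x + h) mod int n else x"
  let ?b = "\<lambda>x. if even x = False then (x + h) mod int n else x"
  show "bij_betw ?a (Zn n) (Zn n)" "bij_betw ?b (Zn n) (Zn n)"
    by (rule bij_betw_Zn_shift_parity[OF n hZ(2)])+
  show "0 \<in> Zn n" using n by (simp add: Zn_def)
  show "?a 0 \<noteq> ?b 0" using hZ h(2) mod_Zn by simp
  fix x y assume "x \<in> Zn n" "y \<in> Zn n"
  have per: "(t + h) mod int n \<in> S \<longleftrightarrow> t mod int n \<in> S" if "even t" for t
    by (rule translate_even_part_eqD[OF n hZ(2) eq that])
  consider "even x" "even y" | "even x" "odd y" | "odd x" "even y" | "odd x" "odd y" by blast
  then show "(?b y - ?a x) mod int n \<in> S \<longleftrightarrow> (y - x) mod int n \<in> S"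
  proof cases
    case 1
    then show ?thesis using per[of "y - x - h"] hZ(2) by (simp add: mod_simps algebra_simps)
  next
    case 4
    then show ?thesis using per[of "y - x"] by (simp add: mod_simps algebra_simps)
  qed (auto simp: mod_simps algebra_simps)
qed

text \<open>Translation by \<open>m\<close> is an involution because 2 m = n, and \<open>l\<close>
  is invertible; so the equation between sets becomes invariance of S under t -> l t + m.\<close>

lemma dilate_eq_translate_half_iff:
  fixes n :: nat and m l :: int
  assumes n: "n > 0" "int n = 2 * m" and S: "S \<subseteq> Zn n" and l: "coprime l (int n)"
  shows "dilate n l S = translate n S m \<longleftrightarrow>
    (\<forall>t. (l * t + m) mod int n \<in> S \<longleftrightarrow> t mod int n \<in> S)"
proof -
  have double: "(t + m + m) mod int n = t mod int n" for t
    using n(2) by (metis add.assoc mod_add_self2 mult_2)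
  have SZ: "s mod int n = s" if "s \<in> S" for s using S mod_Zn that by blast
  show ?thesis
  proof (rule iffI, rule allI)
    fix t
    assume eq: "dilate n l S = translate n S m"
    show "(l * t + m) mod int n \<in> S \<longleftrightarrow> t mod int n \<in> S"
    proof
      assume "t mod int n \<in> S"
      then have "(l * (t mod int n)) mod int n \<in> translate n S m"
        using eq unfolding dilate_def by blast
      then obtain s where s: "s \<in> S" "(l * t) mod int n = (s + m) mod int n"
        by (auto simp: translate_def mod_simps)
      then have "(l * t + m) mod int n = (s + m + m) mod int n" by (metis mod_add_left_eq)
      then show "(l * t + m) mod int n \<in> S" using s(1) SZ double by simp
    next
      assume "(l * t + m) mod int n \<in> S"
      then have "((l * t + m) mod int n + m) mod int n \<in> dilate n l S"
        using eq unfolding translate_def by blast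
      moreover have "((l * t + m) mod int n + m) mod int n = (l * t) mod int n"
        using double by (simp add: mod_simps)
      ultimately obtain s where s: "s \<in> S" "(l * t) mod int n = (l * s) mod int n"
        by (auto simp: dilate_def)
      then have "[t = s] (mod int n)" using cong_mult_lcancel[OF l] by (simp add: cong_def)
      then show "t mod int n \<in> S" using s(1) SZ by (simp add: cong_def)
    qed
  next
    assume inv: "\<forall>t. (l * t + m) mod int n \<in> S \<longleftrightarrow> t mod int n \<in> S"
    show "dilate n l S = translate n S m"
    proof (intro equalityI subsetI)
      fix x assume "x \<in> dilate n l S"
      then obtain s where s: "s \<in> S" "x = (l * s) mod int n" by (auto simp: dilate_def)
      then have "(l * s + m) mod int n \<in> S" using inv SZ by simp
      then have "((l * s + m) mod int n + m) mod int n \<in> translate n S m"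
        unfolding translate_def by blast
      then show "x \<in> translate n S m" using double s(2) by (simp add: mod_simps)
    next
      fix x assume "x \<in> translate n S m"
      then obtain s where s: "s \<in> S" "x = (s + m) mod int n" by (auto simp: translate_def)
      obtain i where "[l * i = 1] (mod int n)" using l cong_solve_coprime_int by blast
      from cong_scalar_right[OF this, of "s + m"]
      have i: "(l * (i * (s + m))) mod int n = (s + m) mod int n"
        by (simp add: cong_def ac_simps)
      then have "(l * (i * (s + m)) + m) mod int n = s"
        using double[of s] SZ[OF s(1)] by (metis mod_add_left_eq)
      then have "i * (s + m) mod int n \<in> S" using inv s(1) by metis
      then have "(l * (i * (s + m) mod int n)) mod int n \<in> dilate n l S"
        unfolding dilate_def by blast
      then show "x \<in> dilate n l S" using i s(2) by (simp add: mod_simps)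
    qed
  qed
qed

text \<open>The layer maps are multiplication by \<open>l\<close> and the same map followed by
  adding \<open>m\<close>; they differ at 0.\<close>

lemma unstable_if_dilate_eq_translate:
  fixes n :: nat and m l :: int
  assumes n: "n > 0" "int n = 2 * m" and S: "S \<subseteq> Zn n" and l: "coprime l (int n)"
    and sym: "\<And>t. (- t) mod int n \<in> S \<longleftrightarrow> t mod int n \<in> S"
    and eq: "dilate n l S = translate n S m"
  shows "unstable (Cay n S)"
proof (rule unstable_if_layered_automorphism[OF sym])
  let ?a = "\<lambda>x. (l * x) mod int n"
  have "inj_on ?a (Zn n)"
    using cong_mult_lcancel[OF l] by (auto simp: inj_on_def cong_def) (metis mod_Zn)
  moreover have "?a ` Zn n \<subseteq> Zn n" using mod_mem_Zn[OF n(1)] by blast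
  ultimately show a: "bij_betw ?a (Zn n) (Zn n)"
    using endo_inj_surj[OF finite_Zn] by (auto simp: bij_betw_def)
  show "bij_betw ((\<lambda>x. (x + m) mod int n) \<circ> ?a) (Zn n) (Zn n)"
    by (rule bij_betw_trans[OF a bij_betw_Zn_add[OF n(1)]])
  show "0 \<in> Zn n" using n by (simp add: Zn_def)
  show "?a 0 \<noteq> ((\<lambda>x. (x + m) mod int n) \<circ> ?a) 0" using n by simp
  fix x y
  have "((\<lambda>x. (x + m) mod int n) \<circ> ?a) y - ?a x = ((l * y) mod int n + m) mod int n - (l * x) mod int n"
    by simp
  moreover have "(((l * y) mod int n + m) mod int n - (l * x) mod int n) mod int n = (l * (y - x) + m) mod int n"
    by (simp add: mod_simps algebra_simps)
  ultimately show "(((\<lambda>x. (x + m) mod int n) \<circ> ?a) y - ?a x) mod int n \<in> S \<longleftrightarrow> (y - x) mod int n \<in> S"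
    using eq dilate_eq_translate_half_iff[OF n S l] by simp
qed

section \<open>From instability to a period of the even part or a multiplier\<close>

lemma squarefree_int:
  assumes "squarefree n"
  shows "squarefree (int n)"
proof (rule squarefreeI)
  fix x :: int assume "x ^ 2 dvd int n"
  moreover have "int (nat \<bar>x\<bar> ^ 2) = x ^ 2" by simp
  ultimately have "nat \<bar>x\<bar> ^ 2 dvd n" by (metis int_dvd_int_iff)
  then have "nat \<bar>x\<bar> dvd 1" using assms squarefreeD by blast
  then show "x dvd 1" by simp
qed

text \<open>For odd \<open>p\<close> the element n/p is even and nonzero, so it would be an excluded
  period if no such pair existed.\<close>

lemma prime_shift_of_even_part:
  fixes n :: nat and p :: int
  assumes n: "n > 0" "even n" and S: "S \<subseteq> Zn n" and p: "prime p" "odd p" "p dvd int n"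
    and no: "\<not> (\<exists>h \<in> even_Zn n. h \<noteq> 0 \<and> translate n (S \<inter> even_Zn n) h = S \<inter> even_Zn n)"
  shows "\<exists>x x'. even x \<and> [x = x'] (mod (int n div p)) \<and> (x mod int n \<in> S) \<noteq> (x' mod int n \<in> S)"
proof (rule ccontr)
  assume *: "\<not> ?thesis"
  define h where "h = int n div p"
  have nh: "int n = p * h" using p(3) by (simp add: h_def)
  have p1: "p > 1" using p(1) prime_gt_1_int by blast
  have h0: "h > 0" using nh n(1) p1 by (metis of_nat_0_less_iff zero_less_mult_pos less_trans zero_less_one)
  have "even (p * h)" using n(2) nh by (metis even_of_nat)
  then have h: "even h" using p(2) by simp
  have "h < int n" using nh h0 p1 by simp
  then have "h \<in> even_Zn n" using h h0 even_Zn_iff[OF n] by (simp add: Zn_def)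
  moreover have "translate n (S \<inter> even_Zn n) h = S \<inter> even_Zn n"
  proof (rule translate_even_part_eqI[OF n h S])
    fix t :: int assume "even t"
    moreover have "[t = t + h] (mod (int n div p))" by (simp add: cong_iff_dvd_diff h_def)
    ultimately show "(t + h) mod int n \<in> S \<longleftrightarrow> t mod int n \<in> S" using * by blast
  qed
  ultimately show False using no h0 by auto
qed

lemma perm_pair_of_bij:
  assumes n: "n > 0" and h: "\<And>b. bij_betw (h b) (Zn n) (Zn n)"
  shows "perm_pair (int n) (\<lambda>b x. h b (x mod int n))"
  unfolding perm_pair_def
proof (intro conjI allI)
  fix b x y
  have "h b (x mod int n) \<in> Zn n" "h b (y mod int n) \<in> Zn n"
    using bij_betw_apply[OF h] mod_mem_Zn[OF n] by blast+
  moreover have "h b (x mod int n) = h b (y mod int n) \<longleftrightarrow> x mod int n = y mod int n"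
    using bij_betw_imp_inj_on[OF h] mod_mem_Zn[OF n] by (auto dest: inj_onD)
  ultimately show "[h b (x mod int n) = h b (y mod int n)] (mod int n) \<longleftrightarrow> [x = y] (mod int n)"
    by (simp add: cong_def mod_Zn)
next
  fix b t
  have "t mod int n \<in> h b ` Zn n"
    using bij_betw_imp_surj_on[OF h] mod_mem_Zn[OF n] by blast
  then obtain x where "x \<in> Zn n" "h b x = t mod int n" by auto
  then show "\<exists>x. [h b (x mod int n) = t] (mod int n)"
    by (intro exI[of _ x]) (simp add: cong_def mod_Zn)
qed

lemma even_part_periodic_or_multiplier_if_unstable:
  fixes n :: nat
  assumes n: "n > 0" "even n" "squarefree n" and S: "S \<subseteq> Zn n"
    and sym: "\<And>t. (- t) mod int n \<in> S \<longleftrightarrow> t mod int n \<in> S"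
    and conn: "Digraph_Component.connected (with_proj (Cay n S))" and nb: "\<not> bipartite (Cay n S)"
    and unst: "unstable (Cay n S)"
    and no: "\<not> (\<exists>h \<in> even_Zn n. h \<noteq> 0 \<and> translate n (S \<inter> even_Zn n) h = S \<inter> even_Zn n)"
  shows "\<exists>l :: nat. l > 0 \<and> coprime l n \<and> dilate n (int l) S = translate n S (int (n div 2))"
proof -
  define m where "m = int (n div 2)"
  have nm: "int n = 2 * m" using n(2) by (auto simp: m_def elim: evenE)
  have sqf: "squarefree (int n)" using n(3) by (rule squarefree_int)
  have m_odd: "odd m"
  proof
    assume "even m"
    then have "2 ^ 2 dvd int n" using nm by (auto elim!: evenE)
    then have "2 dvd (1 :: int)" using squarefreeD[OF sqf] by blast
    then show False by simp
  qed
  obtain h :: "bool \<Rightarrow> int \<Rightarrow> int" and x0 where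
    h: "\<And>b. bij_betw (h b) (Zn n) (Zn n)"
      "\<And>b x y. x \<in> Zn n \<Longrightarrow> y \<in> Zn n \<Longrightarrow> (h (\<not> b) y - h b x) mod int n \<in> S \<longleftrightarrow> (y - x) mod int n \<in> S"
      "x0 \<in> Zn n" "h False x0 \<noteq> h True x0"
    using layered_automorphism_if_unstable[OF n(1) sym conn nb unst] by blast
  define g0 where "g0 = (\<lambda>b x. h b (x mod int n))"
  \<comment> \<open>Recentring at a point where the layer maps differ gives
    \<open>g False 0 = 0\<close> while \<open>g True 0\<close> stays nonzero modulo
    \<open>n\<close>.\<close>
  define g where "g = (\<lambda>b x. g0 b (x + x0) - g0 False x0)"
  define F :: "int \<Rightarrow> int" where "F x = (if x mod int n \<in> S then 1 else 0)" for x
  have "pair_invariant (int n) g0 True F"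
    unfolding pair_invariant_def
  proof (intro conjI allI impI)
    fix b x y
    have "(h (\<not> b) (y mod int n) - h b (x mod int n)) mod int n \<in> S \<longleftrightarrow> (y - x) mod int n \<in> S"
      using h(2)[OF mod_mem_Zn[OF n(1)] mod_mem_Zn[OF n(1)], of b y x] by (simp add: mod_simps)
    then show "F (g0 (b \<noteq> True) y - g0 b x) = F (y - x)" by (simp add: F_def g0_def)
  qed (simp add: F_def cong_def)
  then have F: "pair_invariant (int n) g True F" unfolding g_def by (rule pair_invariant_shift)
  have g: "perm_pair (int n) g"
    unfolding g_def g0_def by (rule perm_pair_shift[OF perm_pair_of_bij[OF n(1) h(1)]])
  have ne: "\<not> [g True 0 = 0] (mod int n)"
  proof
    assume "[g True 0 = 0] (mod int n)"
    then have "h True x0 mod int n = h False x0 mod int n"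
      using mod_Zn[OF h(3)] by (simp add: g_def g0_def cong_iff_dvd_diff mod_eq_dvd_iff)
    moreover have "h b x0 mod int n = h b x0" for b
      using bij_betw_apply[OF h(1) h(3)] mod_Zn by blast
    ultimately show False using h(4) by simp
  qed
  obtain l where l: "coprime l (int n)" "\<And>x. F (l * x + m) = F x"
  proof (rule multiplier_from_pair[OF nm m_odd _ sqf g F])
    fix p :: int assume "prime p" "odd p" "p dvd int n"
    from prime_shift_of_even_part[OF n(1,2) S this no]
    show "\<exists>x x'. even x \<and> [x = x'] (mod int n div p) \<and> F x \<noteq> F x'"
      by (simp add: F_def) metis
  qed (use n ne in \<open>auto simp: F_def g_def\<close>)
  \<comment> \<open>The residue is nonnegative, and it is positive because 0 is not coprime to an
    even number.\<close>
  let ?l = "nat (l mod int n)"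
  have l_int: "int ?l = l mod int n" using n(1) by simp
  have cop: "coprime (int ?l) (int n)" using l(1) n(1) unfolding l_int by simp
  have "?l > 0"
  proof (rule ccontr)
    assume "\<not> ?l > 0"
    then have "is_unit (int n)" using cop by simp
    then show False using n(1,2) by simp
  qed
  moreover have "coprime ?l n" using cop by (simp only: coprime_int_iff)
  moreover have "dilate n (int ?l) S = translate n S m"
  proof (subst dilate_eq_translate_half_iff[OF n(1) nm S cop], rule allI)
    fix t
    have "(l mod int n * t + m) mod int n = (l * t + m) mod int n"
      by (metis mod_add_left_eq mod_mult_left_eq)
    moreover have "(l * t + m) mod int n \<in> S \<longleftrightarrow> t mod int n \<in> S"
      using l(2)[of t] by (simp add: F_def split: if_splits)
    ultimately show "(int ?l * t + m) mod int n \<in> S \<longleftrightarrow> t mod int n \<in> S" unfolding l_int by simp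
  qed
  ultimately show ?thesis unfolding m_def by blast
qed

theorem theorem1p4:
  fixes n :: nat and S :: "int set"
  assumes "n > 0" and "even n" and "squarefree n"
    and "S \<subseteq> Zn n"
    and "S = dilate n (- 1) S"
    and "0 \<notin> S"
    and "Digraph_Component.connected (with_proj (Cay n S))"
    and "\<not> bipartite (Cay n S)"
  shows "unstable (Cay n S) \<longleftrightarrow>
    (\<exists>h \<in> even_Zn n. h \<noteq> 0 \<and> translate n (S \<inter> even_Zn n) h = S \<inter> even_Zn n) \<or>
    (\<exists>l :: nat. l > 0 \<and> coprime l n \<and> dilate n (int l) S = translate n S (int (n div 2)))"
proof -
  note sym = minus_mod_mem_iff[OF assms(1,4,5)]
  have n2: "int n = 2 * int (n div 2)" using assms(2) by (auto elim: evenE)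
  show ?thesis
  proof
    assume "unstable (Cay n S)"
    then show "(\<exists>h \<in> even_Zn n. h \<noteq> 0 \<and> translate n (S \<inter> even_Zn n) h = S \<inter> even_Zn n) \<or>
        (\<exists>l :: nat. l > 0 \<and> coprime l n \<and> dilate n (int l) S = translate n S (int (n div 2)))"
      using even_part_periodic_or_multiplier_if_unstable[OF assms(1-4) sym assms(7,8)] by blast
  next
    assume "(\<exists>h \<in> even_Zn n. h \<noteq> 0 \<and> translate n (S \<inter> even_Zn n) h = S \<inter> even_Zn n) \<or>
        (\<exists>l :: nat. l > 0 \<and> coprime l n \<and> dilate n (int l) S = translate n S (int (n div 2)))"
    then show "unstable (Cay n S)"
    proof (elim disjE bexE exE conjE)
      fix h assume "h \<in> even_Zn n" "h \<noteq> 0" "translate n (S \<inter> even_Zn n) h = S \<inter> even_Zn n"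
      then show ?thesis by (rule unstable_if_even_part_periodic[OF assms(1,2) sym])
    next
      fix l :: nat assume l: "coprime l n" "dilate n (int l) S = translate n S (int (n div 2))"
      have "coprime (int l) (int n)" using l(1) by simp
      then show ?thesis by (rule unstable_if_dilate_eq_translate[OF assms(1) n2 assms(4) _ sym l(2)])
    qed
  qed
qed

end
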